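(* Let $D\subseteq\mathbb{R}^d$ be a convex closed domain and $g_1,\ldots,g_n$ distinct affine linear functions on $D$ such that $\mathrm{int}(D)\cap\{x: g_i(x)=g_j(x)\}\ne\emptyset$ for at least one pair $i\ne j$. Then the map $\varphi:\mathcal{R}\to S_n$ is injective, maps adjacent regions to adjacent permutations, and is an isometric embedding of the weighted region graph $\mathcal{G}$ into the big permutograph $\Upsilon_n$: for all regions $P,Q$, the minimum total weight of a path from $P$ to $Q$ in $\mathcal{G}$ equals $d(\varphi(P),\varphi(Q))$. Consequently, the image $\varphi(\mathcal{G})$ is a permutograph on $S_n$.
   Context: A closed domain in $\mathbb{R}^d$ is the closure of a nonempty open set. $\mathcal{H}$ is the arrangement of all distinct hyperplanes in $\mathbb{R}^d$ that are solution sets of equations $g_i(x)=g_j(x)$ and meet $\mathrm{int}(D)$. $\mathcal{R}$ is the family of nonempty intersections of the regions of $\mathcal{H}$ (connected components of the complement of the union of its hyperplanes) with $\mathrm{int}(D)$; these are called regions. The region graph $\mathcal{G}$ has vertex set $\mathcal{R}$ and edges the pairs of adjacent regions (regions sharing a common facet). On each region $R$ the functions are strictly linearly ordered, $g_{i_1}(x)<\cdots<g_{i_n}(x)$ for all $x\in R$, and $\varphi(R)$ is the permutation $(i_1\cdots i_n)$. Permutations $\alpha=(x_1\cdots x_n)$ of $\{1,\ldots,n\}$ list the images $x_k=k\alpha$ (acting on the right, composed left to right); $d(\alpha,\beta)$ is the number of pairs $\{x,y\}$ appearing in reverse order in $\alpha$ and $\beta$. The edge $PQ$ of $\mathcal{G}$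 has weight $d(\varphi(P),\varphi(Q))$. An ordered partition of $\{1,\ldots,n\}$ is a partition $\pi=(X_1,\ldots,X_m)$ into nonempty sets with $x<y$ whenever $x\in X_i,y\in X_j,i<j$; it is nontrivial if not all blocks are singletons, and then $\tau_\pi$ reverses the order within each block. $\alpha,\beta$ are adjacent if $\alpha\beta^{-1}=\tau_\pi$ for some nontrivial ordered partition $\pi$. The big permutograph $\Upsilon_n$ is the graph on $S_n$ with edges the adjacent pairs, edge $\alpha\beta$ of weight $d(\alpha,\beta)$; a permutograph on $S_n$ is an isometric weighted subgraph of $\Upsilon_n$. *)

theory Defs
  imports
    "HOL-Analysis.Analysis"
    "HOL-Combinatorics.Permutations"
    "HOL-Library.Disjoint_Sets"
    "HOL-Library.Extended_Nat"
begin

section \<open>Weighted graphs\<close>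

text \<open>Simple undirected graphs; an edge is the unordered pair of its ends. The field \<open>weight\<close> is
  relevant only at pairs of ends of edges, and is symmetric there in all graphs below.\<close>

record 'v wgraph =
  verts :: "'v set"
  edges :: "'v set set"
  weight :: "'v \<Rightarrow> 'v \<Rightarrow> nat"

definition is_path :: "'v wgraph \<Rightarrow> 'v \<Rightarrow> 'v list \<Rightarrow> 'v \<Rightarrow> bool" where
  "is_path G u p v \<longleftrightarrow>
     p \<noteq> [] \<and> hd p = u \<and> last p = v \<and> set p \<subseteq> verts G \<and> distinct p \<and>
     successively (\<lambda>x y. {x, y} \<in> edges G) p"

fun path_weight :: "'v wgraph \<Rightarrow> 'v list \<Rightarrow> nat" where
  "path_weight G (x # y # p) = weight G x y + path_weight G (y # p)"
| "path_weight G p = 0"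

text \<open>Minimum total weight of a path. Since \<open>enat\<close> is well-ordered, the infimum is attained as soon
  as there is a path; it is \<open>\<infinity>\<close> otherwise.\<close>

definition wdist :: "'v wgraph \<Rightarrow> 'v \<Rightarrow> 'v \<Rightarrow> enat" where
  "wdist G u v = (INF p \<in> {p. is_path G u p v}. enat (path_weight G p))"

definition weighted_subgraph :: "'v wgraph \<Rightarrow> 'v wgraph \<Rightarrow> bool" where
  "weighted_subgraph H G \<longleftrightarrow>
     verts H \<subseteq> verts G \<and> edges H \<subseteq> edges G \<and> (\<forall>e \<in> edges H. e \<subseteq> verts H) \<and>
     (\<forall>x y. {x, y} \<in> edges H \<longrightarrow> weight H x y = weight G x y)"

definition isometric_weighted_subgraph :: "'v wgraph \<Rightarrow> 'v wgraph \<Rightarrow> bool" where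
  "isometric_weighted_subgraph H G \<longleftrightarrow>
     weighted_subgraph H G \<and> (\<forall>u \<in> verts H. \<forall>v \<in> verts H. wdist H u v = wdist G u v)"

definition isometric_embedding :: "('u \<Rightarrow> 'v) \<Rightarrow> 'u wgraph \<Rightarrow> 'v wgraph \<Rightarrow> bool" where
  "isometric_embedding f G H \<longleftrightarrow>
     inj_on f (verts G) \<and> f ` verts G \<subseteq> verts H \<and>
     (\<forall>x y. {x, y} \<in> edges G \<longrightarrow> {f x, f y} \<in> edges H \<and> weight H (f x) (f y) = weight G x y) \<and>
     (\<forall>u \<in> verts G. \<forall>v \<in> verts G. wdist G u v = wdist H (f u) (f v))"

text \<open>Image of a graph under a map that is injective on its vertices, with the weights carried over.\<close>

definition image_graph :: "('u \<Rightarrow> 'v) \<Rightarrow> 'u wgraph \<Rightarrow> 'v wgraph" where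
  "image_graph f G =
     \<lparr> verts = f ` verts G,
       edges = (\<lambda>e. f ` e) ` edges G,
       weight = (\<lambda>a b. weight G (inv_into (verts G) f a) (inv_into (verts G) f b)) \<rparr>"


section \<open>The big permutograph\<close>

text \<open>The permutation \<open>(x\<^sub>1 \<dots> x\<^sub>n)\<close> is the function \<open>\<alpha>\<close> with \<open>\<alpha> k = x\<^sub>k\<close>. Products in \<open>S\<^sub>n\<close> act on the
  right and are composed left to right, so that \<open>\<alpha>\<beta>\<inverse>\<close> is the function \<open>inv \<beta> \<circ> \<alpha>\<close>.\<close>

definition Sym :: "nat \<Rightarrow> (nat \<Rightarrow> nat) set" where
  "Sym n = {\<alpha>. \<alpha> permutes {1..n}}"

definition before :: "(nat \<Rightarrow> nat) \<Rightarrow> nat \<Rightarrow> nat \<Rightarrow> bool" where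
  "before \<alpha> x y \<longleftrightarrow> inv \<alpha> x < inv \<alpha> y"

definition perm_dist :: "nat \<Rightarrow> (nat \<Rightarrow> nat) \<Rightarrow> (nat \<Rightarrow> nat) \<Rightarrow> nat" where
  "perm_dist n \<alpha> \<beta> =
     card {{x, y} | x y. x \<in> {1..n} \<and> y \<in> {1..n} \<and> before \<alpha> x y \<and> before \<beta> y x}"

definition ordered_partition :: "nat \<Rightarrow> nat set list \<Rightarrow> bool" where
  "ordered_partition n \<pi> \<longleftrightarrow>
     partition_on {1..n} (set \<pi>) \<and> distinct \<pi> \<and>
     (\<forall>i j. i < j \<and> j < length \<pi> \<longrightarrow> (\<forall>x \<in> \<pi> ! i. \<forall>y \<in> \<pi> ! j. x < y))"

definition nontrivial_partition :: "nat set list \<Rightarrow> bool" where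
  "nontrivial_partition \<pi> \<longleftrightarrow> \<not> (\<forall>X \<in> set \<pi>. is_singleton X)"

definition reverses_blocks :: "nat \<Rightarrow> nat set list \<Rightarrow> (nat \<Rightarrow> nat) \<Rightarrow> bool" where
  "reverses_blocks n \<pi> \<tau> \<longleftrightarrow>
     \<tau> permutes {1..n} \<and>
     (\<forall>X \<in> set \<pi>. \<tau> ` X = X \<and> (\<forall>x \<in> X. \<forall>y \<in> X. x < y \<longrightarrow> \<tau> y < \<tau> x))"

definition block_reversal :: "nat \<Rightarrow> nat set list \<Rightarrow> nat \<Rightarrow> nat" where
  "block_reversal n \<pi> = (THE \<tau>. reverses_blocks n \<pi> \<tau>)"

lemma reverses_blocks_unique:
  assumes "ordered_partition n \<pi>" "reverses_blocks n \<pi> s" "reverses_blocks n \<pi> t"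
  shows "s = t"
proof
  fix k
  have P: "partition_on {1..n} (set \<pi>)" using assms(1) by (simp add: ordered_partition_def)
  show "s k = t k"
  proof (cases "k \<in> {1..n}")
    case False
    then show ?thesis using assms unfolding reverses_blocks_def by (metis permutes_not_in)
  next
    case True
    then obtain X where X: "X \<in> set \<pi>" "k \<in> X" using partition_onD1[OF P] by (metis UnionE)
    have "finite X" using partition_onD1[OF P] X(1)
      by (metis Union_upper finite_atLeastAtMost finite_subset)
    have rank: "card {y \<in> X. y < u k} = card {y \<in> X. k < y} \<and> u k \<in> X"
      if u: "reverses_blocks n \<pi> u" for u
    proof
      have img: "u ` X = X" and anti: "\<And>x y. x \<in> X \<Longrightarrow> y \<in> X \<Longrightarrow> x < y \<Longrightarrow> u y < u x"
        and inj: "inj u"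
        using u X(1) by (auto simp: reverses_blocks_def permutes_inj)
      have "{y \<in> X. y < u k} = u ` {y \<in> X. k < y}"
      proof (intro equalityI subsetI)
        fix z assume z: "z \<in> {y \<in> X. y < u k}"
        then obtain y where y: "y \<in> X" "z = u y" using img by blast
        then have "k < y" using z anti[OF y(1) X(2)] by (metis linorder_cases mem_Collect_eq
          order_less_asym order_less_irrefl)
        then show "z \<in> u ` {y \<in> X. k < y}" using y by blast
      next
        fix z assume "z \<in> u ` {y \<in> X. k < y}"
        then obtain y where "y \<in> X" "k < y" "z = u y" by blast
        then show "z \<in> {y \<in> X. y < u k}" using img anti[OF X(2)] by blast
      qed
      then show "card {y \<in> X. y < u k} = card {y \<in> X. k < y}"
        using inj by (simp add: card_image inj_on_subset)
      show "u k \<in> X" using img X(2) by blast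
    qed
    have less: "card {y \<in> X. y < a} < card {y \<in> X. y < b}" if "a \<in> X" "a < b" for a b
      using that \<open>finite X\<close> by (intro psubset_card_mono) auto
    show ?thesis
      using rank[OF assms(2)] rank[OF assms(3)] less[of "s k" "t k"] less[of "t k" "s k"] by linarith
  qed
qed

lemma ordered_partition_block:
  assumes "ordered_partition n \<pi>" "X \<in> set \<pi>"
  shows "X = {Min X..Max X}"
proof -
  have P: "partition_on {1..n} (set \<pi>)" using assms(1) by (simp add: ordered_partition_def)
  have sub: "X \<subseteq> {1..n}" and ne: "X \<noteq> {}" using P assms(2) by (auto simp: partition_on_def)
  then have fin: "finite X" using finite_subset by blast
  have "k \<in> X" if k: "Min X \<le> k" "k \<le> Max X" for k
  proof -
    have mm: "Min X \<in> X" "Max X \<in> X" using fin ne by auto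
    then have "k \<in> {1..n}" using sub k by (meson atLeastAtMost_iff order_trans subsetD)
    then obtain Y where Y: "Y \<in> set \<pi>" "k \<in> Y" using partition_onD1[OF P] by (metis UnionE)
    obtain i j where ij: "i < length \<pi>" "\<pi> ! i = X" "j < length \<pi>" "\<pi> ! j = Y"
      using assms(2) Y(1) by (metis in_set_conv_nth)
    have "\<not> i < j" "\<not> j < i"
      using assms(1) ij Y(2) mm k unfolding ordered_partition_def
      by (metis leD)+
    then have "i = j" by simp
    then show ?thesis using ij Y by simp
  qed
  then have "{Min X..Max X} \<subseteq> X" by (meson atLeastAtMost_iff subsetI)
  moreover have "X \<subseteq> {Min X..Max X}" using fin by (meson Max_ge Min_le atLeastAtMost_iff subsetI)
  ultimately show ?thesis by (rule equalityI[rotated])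
qed

lemma reverses_blocks_exists:
  assumes "ordered_partition n \<pi>"
  shows "\<exists>\<tau>. reverses_blocks n \<pi> \<tau>"
proof -
  have P: "partition_on {1..n} (set \<pi>)" using assms by (simp add: ordered_partition_def)
  define B where "B k = (THE X. X \<in> set \<pi> \<and> k \<in> X)" for k
  define t where "t k = (if k \<in> {1..n} then Min (B k) + Max (B k) - k else k)" for k
  have B: "B k = X" if "X \<in> set \<pi>" "k \<in> X" for k X
    unfolding B_def
  proof (rule the_equality)
    show "X \<in> set \<pi> \<and> k \<in> X" using that by simp
    show "Y = X" if "Y \<in> set \<pi> \<and> k \<in> Y" for Y
      using that \<open>X \<in> set \<pi>\<close> \<open>k \<in> X\<close> partition_onD2[OF P] by (auto dest: disjointD)
  qed
  have sub: "X \<subseteq> {1..n}" if "X \<in> set \<pi>" for X using P that by (auto simp: partition_on_def)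
  have tX: "t k = Min X + Max X - k" if "X \<in> set \<pi>" "k \<in> X" for k X
    using that B sub[OF that(1)] by (auto simp: t_def)
  have bd: "Min X \<le> k \<and> k \<le> Max X" if "X \<in> set \<pi>" "k \<in> X" for k X
    using ordered_partition_block[OF assms that(1)] that(2) by (metis atLeastAtMost_iff)
  have mem: "t k \<in> X" and inv: "t (t k) = k" if "X \<in> set \<pi>" "k \<in> X" for k X
  proof -
    have "t k \<in> {Min X..Max X}" using tX[OF that] bd[OF that] by auto
    then show m: "t k \<in> X" using ordered_partition_block[OF assms that(1)] by metis
    show "t (t k) = k" using tX[OF that] tX[OF that(1) m] bd[OF that] by linarith
  qed
  have invol: "t (t k) = k" for k
  proof (cases "k \<in> {1..n}")
    case True
    then obtain X where "X \<in> set \<pi>" "k \<in> X" using partition_onD1[OF P] by (metis UnionE)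
    then show ?thesis by (rule inv)
  qed (auto simp: t_def)
  have "t permutes {1..n}"
    unfolding permutes_def
  proof (intro conjI allI impI)
    show "t k = k" if "k \<notin> {1..n}" for k using that by (auto simp: t_def)
    show "\<exists>!x. t x = y" for y
      by (rule ex1I[of _ "t y"]) (use invol in auto)
  qed
  moreover have "t ` X = X" if "X \<in> set \<pi>" for X
  proof
    show "t ` X \<subseteq> X" using mem[OF that] by blast
    show "X \<subseteq> t ` X"
    proof
      fix k assume "k \<in> X"
      then have "t k \<in> X" "k = t (t k)" using mem[OF that] invol by auto
      then show "k \<in> t ` X" by blast
    qed
  qed
  moreover have "t y < t x" if "X \<in> set \<pi>" "x \<in> X" "y \<in> X" "x < y" for X x y
    using tX[OF that(1,2)] tX[OF that(1,3)] bd[OF that(1,2)] bd[OF that(1,3)] that(4) by linarith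
  ultimately show ?thesis unfolding reverses_blocks_def by blast
qed

lemma reverses_blocks_block_reversal:
  "ordered_partition n \<pi> \<Longrightarrow> reverses_blocks n \<pi> (block_reversal n \<pi>)"
  unfolding block_reversal_def
  using reverses_blocks_exists[of n \<pi>] reverses_blocks_unique[of n \<pi>]
  by (intro theI'[of "reverses_blocks n \<pi>"]) metis

definition adjacent_perms :: "nat \<Rightarrow> (nat \<Rightarrow> nat) \<Rightarrow> (nat \<Rightarrow> nat) \<Rightarrow> bool" where
  "adjacent_perms n \<alpha> \<beta> \<longleftrightarrow>
     \<alpha> \<in> Sym n \<and> \<beta> \<in> Sym n \<and>
     (\<exists>\<pi>. ordered_partition n \<pi> \<and> nontrivial_partition \<pi> \<and> inv \<beta> \<circ> \<alpha> = block_reversal n \<pi>)"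

definition big_permutograph :: "nat \<Rightarrow> (nat \<Rightarrow> nat) wgraph" where
  "big_permutograph n =
     \<lparr> verts = Sym n,
       edges = {{\<alpha>, \<beta>} | \<alpha> \<beta>. adjacent_perms n \<alpha> \<beta>},
       weight = perm_dist n \<rparr>"

definition permutograph :: "nat \<Rightarrow> (nat \<Rightarrow> nat) wgraph \<Rightarrow> bool" where
  "permutograph n H \<longleftrightarrow> isometric_weighted_subgraph H (big_permutograph n)"


section \<open>The region graph of a family of affine functions\<close>

definition closed_domain :: "'a::topological_space set \<Rightarrow> bool" where
  "closed_domain D \<longleftrightarrow> (\<exists>U. open U \<and> U \<noteq> {} \<and> D = closure U)"

definition affine_fun :: "('a::real_inner \<Rightarrow> real) \<Rightarrow> bool" where
  "affine_fun f \<longleftrightarrow> (\<exists>a b. \<forall>x. f x = a \<bullet> x + b)"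

definition hyperplane :: "'a::real_inner set \<Rightarrow> bool" where
  "hyperplane h \<longleftrightarrow> (\<exists>a b. a \<noteq> 0 \<and> h = {x. a \<bullet> x = b})"

definition arrangement :: "'a::euclidean_space set \<Rightarrow> nat \<Rightarrow> (nat \<Rightarrow> 'a \<Rightarrow> real) \<Rightarrow> 'a set set" where
  "arrangement D n g =
     {h. hyperplane h \<and> h \<inter> interior D \<noteq> {} \<and>
         (\<exists>i \<in> {1..n}. \<exists>j \<in> {1..n}. h = {x. g i x = g j x})}"

definition regions :: "'a::euclidean_space set \<Rightarrow> nat \<Rightarrow> (nat \<Rightarrow> 'a \<Rightarrow> real) \<Rightarrow> 'a set set" where
  "regions D n g =
     {C \<inter> interior D | C. C \<in> components (- \<Union> (arrangement D n g)) \<and> C \<inter> interior D \<noteq> {}}"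

text \<open>Regions are open convex sets; their facets are the facets of their closures.\<close>

definition adjacent_regions :: "'a::euclidean_space set \<Rightarrow> 'a set \<Rightarrow> bool" where
  "adjacent_regions P Q \<longleftrightarrow>
     P \<noteq> Q \<and> (\<exists>F. F facet_of closure P \<and> F facet_of closure Q)"

definition orders :: "nat \<Rightarrow> (nat \<Rightarrow> 'a \<Rightarrow> real) \<Rightarrow> 'a set \<Rightarrow> (nat \<Rightarrow> nat) \<Rightarrow> bool" where
  "orders n g R \<alpha> \<longleftrightarrow>
     (\<forall>x \<in> R. \<forall>k \<in> {1..n}. \<forall>l \<in> {1..n}. k < l \<longrightarrow> g (\<alpha> k) x < g (\<alpha> l) x)"

definition region_perm :: "nat \<Rightarrow> (nat \<Rightarrow> 'a \<Rightarrow> real) \<Rightarrow> 'a set \<Rightarrow> nat \<Rightarrow> nat" where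
  "region_perm n g R = (THE \<alpha>. \<alpha> \<in> Sym n \<and> orders n g R \<alpha>)"

definition region_graph ::
    "'a::euclidean_space set \<Rightarrow> nat \<Rightarrow> (nat \<Rightarrow> 'a \<Rightarrow> real) \<Rightarrow> 'a set wgraph" where
  "region_graph D n g =
     \<lparr> verts = regions D n g,
       edges = {{P, Q} | P Q. P \<in> regions D n g \<and> Q \<in> regions D n g \<and> adjacent_regions P Q},
       weight = (\<lambda>P Q. perm_dist n (region_perm n g P) (region_perm n g Q)) \<rparr>"

end

theory Submission
  imports Defs
begin

text \<open>Let \<open>f\<^sub>i\<^sub>j = g\<^sub>j - g\<^sub>i\<close>. The regions are the sets of points of \<open>int D\<close> on which all \<open>f\<^sub>i\<^sub>j\<close> have
  prescribed nonzero signs, so a region is determined by its permutation. If two regions share a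
  facet \<open>F\<close>, every \<open>f\<^sub>i\<^sub>j\<close> that changes sign between them vanishes on \<open>F\<close>, and all those vanishing on \<open>F\<close>
  are proportional, so they change sign together; the classes of indices with equal restriction to
  \<open>F\<close> are the blocks that get reversed. Distances are bounded below by the triangle inequality for
  inversion sets. Conversely, walk from \<open>p \<in> P\<close> to a generic \<open>q \<in> Q\<close> along a segment: the first
  hyperplane crossed leads to a region adjacent to \<open>P\<close> whose permutation lies between those of \<open>P\<close>
  and \<open>Q\<close>, and the distances add up.\<close>

section \<open>Permutations and inversions\<close>

lemma SymD: "\<alpha> \<in> Sym n \<Longrightarrow> \<alpha> permutes {1..n}"
  by (simp add: Sym_def)

lemma Sym_inv_in:
  assumes "\<alpha> \<in> Sym n" "i \<in> {1..n}" shows "inv \<alpha> i \<in> {1..n}"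
  using assms permutes_in_image[OF permutes_inv[OF SymD[OF assms(1)]]] by blast

text \<open>The elements placed no later than \<open>i\<close> are the images of
  \<open>1, ..., inv \<alpha> i\<close>. A position is thus a count that depends only on the
  relation \<open>before\<close>.\<close>

lemma Sym_inv_eq_card:
  assumes "\<alpha> \<in> Sym n" "i \<in> {1..n}"
  shows "inv \<alpha> i = card {j \<in> {1..n}. inv \<alpha> j \<le> inv \<alpha> i}"
proof -
  note p = SymD[OF assms(1)]
  have "{j \<in> {1..n}. inv \<alpha> j \<le> inv \<alpha> i} = \<alpha> ` {1..inv \<alpha> i}"
  proof (intro equalityI subsetI)
    fix j assume j: "j \<in> {j \<in> {1..n}. inv \<alpha> j \<le> inv \<alpha> i}"
    then have "inv \<alpha> j \<in> {1..inv \<alpha> i}" using Sym_inv_in[OF assms(1), of j] by auto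
    then show "j \<in> \<alpha> ` {1..inv \<alpha> i}" using permutes_inverses(1)[OF p] by (metis imageI)
  next
    fix j assume "j \<in> \<alpha> ` {1..inv \<alpha> i}"
    then obtain k where k: "k \<in> {1..inv \<alpha> i}" "j = \<alpha> k" by blast
    then have "k \<in> {1..n}" using Sym_inv_in[OF assms] by auto
    then show "j \<in> {j \<in> {1..n}. inv \<alpha> j \<le> inv \<alpha> i}"
      using k permutes_in_image[OF p, of k] permutes_inverses(2)[OF p, of k] by auto
  qed
  then show ?thesis
    using card_image[OF permutes_inj_on[OF p]] by simp
qed

lemma before_linear:
  assumes "\<alpha> \<in> Sym n" "i \<noteq> j" shows "before \<alpha> i j \<or> before \<alpha> j i"
  using permutes_inj[OF permutes_inv[OF SymD[OF assms(1)]]] assms(2)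
  unfolding before_def by (metis injD nat_neq_iff)

lemma before_asym: "before \<alpha> i j \<Longrightarrow> \<not> before \<alpha> j i"
  by (simp add: before_def)

text \<open>By \<open>Sym_inv_eq_card\<close> the relation \<open>before\<close> fixes every
  position on \<open>{1..n}\<close>; outside, both inverses are the identity.\<close>

lemma Sym_eqI:
  assumes "\<alpha> \<in> Sym n" "\<beta> \<in> Sym n"
    and "\<And>i j. i \<in> {1..n} \<Longrightarrow> j \<in> {1..n} \<Longrightarrow> before \<alpha> i j \<longleftrightarrow> before \<beta> i j"
  shows "\<alpha> = \<beta>"
proof -
  have "inv \<alpha> i = inv \<beta> i" for i
  proof (cases "i \<in> {1..n}")
    case True
    have "{j \<in> {1..n}. inv \<alpha> j \<le> inv \<alpha> i} = {j \<in> {1..n}. inv \<beta> j \<le> inv \<beta> i}"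
      using assms(3)[OF True] unfolding before_def by (auto simp: not_less[symmetric])
    then show ?thesis using Sym_inv_eq_card[OF assms(1) True] Sym_inv_eq_card[OF assms(2) True] by simp
  next
    case False
    then show ?thesis
      using permutes_not_in[OF permutes_inv[OF SymD]] assms(1,2) by metis
  qed
  then have "inv \<alpha> = inv \<beta>" by blast
  then show ?thesis using inv_inv_eq permutes_bij[OF SymD] assms(1,2) by metis
qed

text \<open>Monotonicity gives one direction and totality of \<open>before\<close> the other. With
  \<open>f i\<close> the value of \<open>g i\<close> at a point, this turns the order in a
  permutation into a comparison of values.\<close>

lemma Sym_before_iff:
  fixes f :: "nat \<Rightarrow> 'b::linorder"
  assumes "\<alpha> \<in> Sym n" and "\<And>k l. k \<in> {1..n} \<Longrightarrow> l \<in> {1..n} \<Longrightarrow> k < l \<Longrightarrow> f (\<alpha> k) < f (\<alpha> l)"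
    and "i \<in> {1..n}" "j \<in> {1..n}"
  shows "before \<alpha> i j \<longleftrightarrow> f i < f j"
proof -
  note p = SymD[OF assms(1)]
  have "before \<alpha> i j \<Longrightarrow> f i < f j" if "i \<in> {1..n}" "j \<in> {1..n}" for i j
    using assms(2)[OF Sym_inv_in[OF assms(1) that(1)] Sym_inv_in[OF assms(1) that(2)]]
    unfolding before_def permutes_inverses(1)[OF p] by simp
  then show ?thesis using before_linear[OF assms(1), of i j] assms(3,4)
    by (metis order_less_asym order_less_irrefl)
qed

text \<open>The inverse of the rank function \<open>r\<close> sorts the values: \<open>r\<close>
  increases strictly with \<open>f\<close>, so it is an injective self-map of a finite set and hence
  a permutation.\<close>

lemma sorting_Sym_exists:
  fixes f :: "nat \<Rightarrow> 'b::linorder"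
  assumes "inj_on f {1..n}"
  shows "\<exists>\<alpha> \<in> Sym n. \<forall>k \<in> {1..n}. \<forall>l \<in> {1..n}. k < l \<longrightarrow> f (\<alpha> k) < f (\<alpha> l)"
proof -
  define r where "r i = (if i \<in> {1..n} then card {j \<in> {1..n}. f j \<le> f i} else i)" for i
  have mono: "r i < r j" if "i \<in> {1..n}" "j \<in> {1..n}" "f i < f j" for i j
  proof -
    have "f k \<le> f j" if "f k \<le> f i" for k using that \<open>f i < f j\<close> by simp
    then have "{k \<in> {1..n}. f k \<le> f i} \<subseteq> {k \<in> {1..n}. f k \<le> f j}" by blast
    moreover have "j \<notin> {k \<in> {1..n}. f k \<le> f i}" "j \<in> {k \<in> {1..n}. f k \<le> f j}"
      using that by auto
    ultimately have "{k \<in> {1..n}. f k \<le> f i} \<subset> {k \<in> {1..n}. f k \<le> f j}" by blast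
    then show ?thesis using that psubset_card_mono[of "{k \<in> {1..n}. f k \<le> f j}"]
      by (simp add: r_def)
  qed
  have "inj_on r {1..n}"
  proof (rule inj_onI)
    fix i j assume ij: "i \<in> {1..n}" "j \<in> {1..n}" "r i = r j"
    then have "f i = f j" using mono by (metis less_irrefl linorder_cases)
    then show "i = j" using assms ij by (auto dest: inj_onD)
  qed
  moreover have "r ` {1..n} \<subseteq> {1..n}"
  proof
    fix k assume "k \<in> r ` {1..n}"
    then obtain i where i: "i \<in> {1..n}" "k = r i" by blast
    have "i \<in> {j \<in> {1..n}. f j \<le> f i}" using i by simp
    then have "0 < r i" using i by (auto simp: r_def card_gt_0_iff)
    moreover have "r i \<le> card {1..n}" unfolding r_def using i
      by (simp, intro card_mono[of "{1..n}", simplified]) auto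
    ultimately show "k \<in> {1..n}" using i by simp
  qed
  ultimately have "bij_betw r {1..n} {1..n}"
    by (simp add: bij_betw_def endo_inj_surj)
  then have p: "r permutes {1..n}" by (rule bij_imp_permutes) (auto simp: r_def)
  have "f (inv r k) < f (inv r l)" if "k \<in> {1..n}" "l \<in> {1..n}" "k < l" for k l
  proof (rule ccontr)
    assume n: "\<not> f (inv r k) < f (inv r l)"
    have m: "inv r k \<in> {1..n}" "inv r l \<in> {1..n}"
      using that permutes_in_image[OF permutes_inv[OF p]] by blast+
    have "inv r k \<noteq> inv r l" using that permutes_inverses(1)[OF p] by (metis less_irrefl)
    then have "f (inv r l) < f (inv r k)" using n m assms by (metis inj_onD linorder_cases)
    then show False using mono[OF m(2,1)] that permutes_inverses(1)[OF p] by simp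
  qed
  then show ?thesis using permutes_inv[OF p] unfolding Sym_def by blast
qed

section \<open>Inversion sets and additivity of the distance\<close>

definition inversions :: "nat \<Rightarrow> (nat \<Rightarrow> nat) \<Rightarrow> (nat \<Rightarrow> nat) \<Rightarrow> nat set set" where
  "inversions n \<alpha> \<beta> = {{x, y} | x y. x \<in> {1..n} \<and> y \<in> {1..n} \<and> before \<alpha> x y \<and> before \<beta> y x}"

lemma perm_dist_eq_card: "perm_dist n \<alpha> \<beta> = card (inversions n \<alpha> \<beta>)"
  by (simp add: perm_dist_def inversions_def)

lemma finite_inversions: "finite (inversions n \<alpha> \<beta>)"
proof (rule finite_subset)
  show "inversions n \<alpha> \<beta> \<subseteq> Pow {1..n}" unfolding inversions_def by auto
qed simp

lemma perm_dist_self: "perm_dist n \<alpha> \<alpha> = 0"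
proof -
  have "inversions n \<alpha> \<alpha> = {}" using before_asym unfolding inversions_def by blast
  then show ?thesis by (simp add: perm_dist_eq_card)
qed

lemma perm_dist_pos:
  assumes "\<alpha> \<in> Sym n" "\<beta> \<in> Sym n" "\<alpha> \<noteq> \<beta>"
  shows "0 < perm_dist n \<alpha> \<beta>"
proof -
  obtain i j where ij: "i \<in> {1..n}" "j \<in> {1..n}" "before \<alpha> i j \<noteq> before \<beta> i j"
    using Sym_eqI[OF assms(1,2)] assms(3) by blast
  then have "i \<noteq> j" by (auto simp: before_def)
  then have "{i, j} \<in> inversions n \<alpha> \<beta>"
    using ij before_linear[OF assms(1)] before_linear[OF assms(2)]
    unfolding inversions_def by blast
  then show ?thesis using finite_inversions unfolding perm_dist_eq_card card_gt_0_iff by blast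
qed

text \<open>Since \<beta> puts every pair in one of its two orders, a pair reversed from \<alpha> to
  \<gamma> is reversed from \<alpha> to \<beta> or from \<beta> to \<gamma>.\<close>

lemma perm_dist_triangle:
  assumes "\<beta> \<in> Sym n"
  shows "perm_dist n \<alpha> \<gamma> \<le> perm_dist n \<alpha> \<beta> + perm_dist n \<beta> \<gamma>"
proof -
  have "inversions n \<alpha> \<gamma> \<subseteq> inversions n \<alpha> \<beta> \<union> inversions n \<beta> \<gamma>"
  proof
    fix e assume "e \<in> inversions n \<alpha> \<gamma>"
    then obtain x y where "e = {x, y}" "x \<in> {1..n}" "y \<in> {1..n}" "before \<alpha> x y" "before \<gamma> y x"
      unfolding inversions_def by blast
    moreover have "before \<beta> x y \<or> before \<beta> y x"
      using calculation before_linear[OF assms, of x y] by (auto simp: before_def)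
    ultimately show "e \<in> inversions n \<alpha> \<beta> \<union> inversions n \<beta> \<gamma>"
      unfolding inversions_def by blast
  qed
  then have "card (inversions n \<alpha> \<gamma>) \<le> card (inversions n \<alpha> \<beta> \<union> inversions n \<beta> \<gamma>)"
    using finite_inversions by (intro card_mono) auto
  then show ?thesis using card_Un_le le_trans unfolding perm_dist_eq_card by blast
qed

text \<open>By hypothesis \<beta> respects the pairs on which \<alpha> and \<gamma> agree. Hence no
  pair is reversed twice on the way through \<beta>, and the two inversion sets split that of
  \<alpha> and \<gamma>.\<close>

lemma perm_dist_between:
  assumes "\<alpha> \<in> Sym n" "\<beta> \<in> Sym n" "\<gamma> \<in> Sym n"
    and "\<And>i j. i \<in> {1..n} \<Longrightarrow> j \<in> {1..n} \<Longrightarrow> before \<alpha> i j \<Longrightarrow> before \<gamma> i j \<Longrightarrow> before \<beta> i j"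
  shows "perm_dist n \<alpha> \<gamma> = perm_dist n \<alpha> \<beta> + perm_dist n \<beta> \<gamma>"
proof -
  have 1: "inversions n \<alpha> \<beta> \<subseteq> inversions n \<alpha> \<gamma>"
  proof
    fix e assume "e \<in> inversions n \<alpha> \<beta>"
    then obtain x y where e: "e = {x, y}" "x \<in> {1..n}" "y \<in> {1..n}" "before \<alpha> x y" "before \<beta> y x"
      unfolding inversions_def by blast
    then have "before \<gamma> y x"
      using assms(4)[of x y] before_asym before_linear[OF assms(3), of x y] by blast
    then show "e \<in> inversions n \<alpha> \<gamma>" using e unfolding inversions_def by blast
  qed
  have 2: "inversions n \<beta> \<gamma> \<subseteq> inversions n \<alpha> \<gamma>"
  proof
    fix e assume "e \<in> inversions n \<beta> \<gamma>"
    then obtain x y where e: "e = {x, y}" "x \<in> {1..n}" "y \<in> {1..n}" "before \<beta> x y" "before \<gamma> y x"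
      unfolding inversions_def by blast
    then have "before \<alpha> x y"
      using assms(4)[of y x] before_asym before_linear[OF assms(1), of x y] by blast
    then show "e \<in> inversions n \<alpha> \<gamma>" using e unfolding inversions_def by blast
  qed
  have 3: "inversions n \<alpha> \<beta> \<inter> inversions n \<beta> \<gamma> = {}"
  proof -
    have False if e1: "e \<in> inversions n \<alpha> \<beta>" and e2: "e \<in> inversions n \<beta> \<gamma>" for e
    proof -
      obtain x y where e: "e = {x, y}" "x \<in> {1..n}" "y \<in> {1..n}" "before \<alpha> x y" "before \<beta> y x"
        using e1 unfolding inversions_def by blast
      obtain u v where uv: "e = {u, v}" "before \<beta> u v" "before \<gamma> v u"
        using e2 unfolding inversions_def by blast
      have "u = y \<and> v = x" using e uv before_asym by (metis doubleton_eq_iff)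
      then show False using assms(4)[of x y] e uv before_asym by blast
    qed
    then show ?thesis by blast
  qed
  have "perm_dist n \<alpha> \<beta> + perm_dist n \<beta> \<gamma> = card (inversions n \<alpha> \<beta> \<union> inversions n \<beta> \<gamma>)"
    unfolding perm_dist_eq_card
    using card_Un_disjoint[OF finite_inversions finite_inversions 3] by simp
  also have "\<dots> \<le> perm_dist n \<alpha> \<gamma>" unfolding perm_dist_eq_card
    using 1 2 finite_inversions by (intro card_mono) auto
  finally show ?thesis using perm_dist_triangle[OF assms(2), of \<alpha> \<gamma>] by linarith
qed

text \<open>The blocks of the ordered partition are the fibres of \<open>c\<close>. A fibre \<open>{a..b}\<close> is mapped into
  itself because \<open>s\<close> keeps the numbers below \<open>a\<close> below it and the numbers above \<open>b\<close> above it.\<close>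

lemma block_reversal_of_fibres:
  fixes c :: "nat \<Rightarrow> 'b"
  assumes s: "s permutes {1..n}"
    and conv: "\<And>k l m. k \<in> {1..n} \<Longrightarrow> m \<in> {1..n} \<Longrightarrow> k < l \<Longrightarrow> l < m \<Longrightarrow> c k = c m \<Longrightarrow> c l = c k"
    and rev: "\<And>k l. k \<in> {1..n} \<Longrightarrow> l \<in> {1..n} \<Longrightarrow> k < l \<Longrightarrow> c k = c l \<Longrightarrow> s l < s k"
    and keep: "\<And>k l. k \<in> {1..n} \<Longrightarrow> l \<in> {1..n} \<Longrightarrow> k < l \<Longrightarrow> c k \<noteq> c l \<Longrightarrow> s k < s l"
    and nontriv: "k0 \<in> {1..n}" "l0 \<in> {1..n}" "k0 \<noteq> l0" "c k0 = c l0"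
  shows "\<exists>\<pi>. ordered_partition n \<pi> \<and> nontrivial_partition \<pi> \<and> s = block_reversal n \<pi>"
proof -
  define B where "B k = {l \<in> {1..n}. c l = c k}" for k
  \<comment> \<open>The least elements of the fibres serve as representatives; sorting them lists
    the blocks in increasing order.\<close>
  define M where "M = {k \<in> {1..n}. \<forall>l \<in> {1..<k}. c l \<noteq> c k}"
  define \<pi> where "\<pi> = map B (sorted_list_of_set M)"
  have fM: "finite M" by (simp add: M_def)
  have M_le: "k \<le> l" if "k \<in> M" "l \<in> B k" for k l
    using that unfolding M_def B_def by (auto simp: not_less[symmetric])
  have ex: "\<exists>m \<in> M. B m = B k \<and> k \<in> B m" if k: "k \<in> {1..n}" for k
  proof -
    define m where "m = (LEAST l. l \<in> B k)"
    have "k \<in> B k" using k by (simp add: B_def)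
    then have m: "m \<in> B k" unfolding m_def by (rule LeastI)
    have "c l \<noteq> c m" if "l \<in> {1..<m}" for l
    proof
      assume "c l = c m"
      then have "l \<in> B k" using m that by (auto simp: B_def)
      then show False using not_less_Least[of l "\<lambda>l. l \<in> B k"] that unfolding m_def by auto
    qed
    then have "m \<in> M" using m by (auto simp: M_def B_def)
    moreover have "B m = B k" using m by (auto simp: B_def)
    ultimately show ?thesis using \<open>k \<in> B k\<close> by blast
  qed
  have set\<pi>: "set \<pi> = B ` {1..n}"
  proof -
    have "set \<pi> = B ` M" using fM by (simp add: \<pi>_def)
    moreover have "B ` M \<subseteq> B ` {1..n}" by (auto simp: M_def)
    moreover have "B ` {1..n} \<subseteq> B ` M"
    proof
      fix X assume "X \<in> B ` {1..n}"
      then obtain k where "k \<in> {1..n}" "X = B k" by blast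
      then show "X \<in> B ` M" using ex[of k] by auto
    qed
    ultimately show ?thesis by (simp only: order_antisym)
  qed
  have injB: "inj_on B M"
  proof (rule inj_onI)
    fix a b assume ab: "a \<in> M" "b \<in> M" "B a = B b"
    have "a \<in> B a" "b \<in> B b" using ab(1,2) by (auto simp: B_def M_def)
    then have "b \<in> B a" "a \<in> B b" by (simp_all add: ab(3))
    then show "a = b" using M_le[OF ab(1)] M_le[OF ab(2)] by (meson order_antisym)
  qed
  have "partition_on {1..n} (set \<pi>)"
    unfolding set\<pi> by (rule partition_onI) (auto simp: B_def disjnt_def)
  moreover have "distinct \<pi>" using injB fM by (simp add: \<pi>_def distinct_map)
  moreover have "x < y" if ij: "i < j" "j < length \<pi>" and x: "x \<in> \<pi> ! i" and y: "y \<in> \<pi> ! j" for i j x y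
  proof (rule ccontr)
    assume nxy: "\<not> x < y"
    define a where "a = sorted_list_of_set M ! i"
    define b where "b = sorted_list_of_set M ! j"
    have len: "i < length (sorted_list_of_set M)" "j < length (sorted_list_of_set M)"
      using ij by (auto simp: \<pi>_def)
    have ab: "a \<in> M" "b \<in> M" "a < b"
      using len ij nth_mem[OF len(1)] nth_mem[OF len(2)] fM
        sorted_wrt_nth_less[OF strict_sorted_list_of_set[of M], of i j]
      by (auto simp: a_def b_def)
    have xB: "x \<in> B a" and yB: "y \<in> B b" using x y len by (auto simp: \<pi>_def a_def b_def)
    have ne: "c a \<noteq> c b"
    proof
      assume "c a = c b"
      then have "B a = B b" by (simp add: B_def)
      then show False using ab inj_onD[OF injB] by blast
    qed
    have "x \<noteq> y" using xB yB ne by (auto simp: B_def)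
    then have "y < x" using nxy by simp
    \<comment> \<open>Now \<open>a < y < x\<close> with \<open>a\<close> and \<open>x\<close> in one
      fibre, so \<open>conv\<close> pulls \<open>y\<close> into it, although \<open>y\<close> lies
      in the fibre of \<open>b\<close>.\<close>
    moreover have "a < y" using ab M_le[OF ab(2) yB] by simp
    ultimately have "c y = c a" using conv[of a x y] xB ab by (auto simp: B_def M_def)
    then show False using yB ne by (simp add: B_def)
  qed
  ultimately have op: "ordered_partition n \<pi>" unfolding ordered_partition_def by blast
  have "k0 \<in> B k0" "l0 \<in> B k0" using nontriv by (auto simp: B_def)
  then have "\<not> is_singleton (B k0)" using nontriv(3) by (metis is_singleton_def singletonD)
  then have nt: "nontrivial_partition \<pi>"
    using nontriv(1) unfolding nontrivial_partition_def set\<pi> by blast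
  have sin: "s k \<in> {1..n}" if "k \<in> {1..n}" for k using permutes_in_image[OF s] that by blast
  have inj: "inj s" using s by (rule permutes_inj)
  have maps: "s k \<in> B k" if k: "k \<in> {1..n}" for k
  proof (rule ccontr)
    assume "s k \<notin> B k"
    then have ne: "c (s k) \<noteq> c k" using sin[OF k] by (simp add: B_def)
    then have "s k \<noteq> k" by metis
    then consider "s k < k" | "k < s k" by linarith
    then show False
    proof cases
      case 1
      \<comment> \<open>By \<open>ne\<close> and \<open>conv\<close> no number up to
        \<open>s k\<close> lies in the fibre of \<open>k\<close>, so \<open>keep\<close> sends all
        of them strictly below \<open>s k\<close>: an injection of \<open>s k\<close> numbers into
        \<open>s k - 1\<close> places. The other case is the mirror image.\<close>
      have "s l \<in> {1..<s k}" if "l \<in> {1..s k}" for l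
      proof -
        have l: "l \<in> {1..n}" "l < k" using that 1 k by auto
        have "c l \<noteq> c k" using conv[of l k "s k"] l k that ne 1 by (cases "l = s k") auto
        then show ?thesis using keep[of l k] l k sin by auto
      qed
      then have "s ` {1..s k} \<subseteq> {1..<s k}" by blast
      then have "card {1..s k} \<le> card {1..<s k}"
        using card_inj_on_le[of s "{1..s k}" "{1..<s k}"] inj_on_subset[OF inj] by blast
      then show False using sin[OF k] by auto
    next
      case 2
      have "s l \<in> {s k<..n}" if "l \<in> {s k..n}" for l
      proof -
        have l: "l \<in> {1..n}" "k < l" using that 2 k by auto
        have "c k \<noteq> c l" using conv[of k l "s k"] l k that ne 2 by (cases "l = s k") auto
        then show ?thesis using keep[of k l] l k sin by auto
      qed
      then have "s ` {s k..n} \<subseteq> {s k<..n}" by blast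
      then have "card {s k..n} \<le> card {s k<..n}"
        using card_inj_on_le[of s "{s k..n}" "{s k<..n}"] inj_on_subset[OF inj] by blast
      then show False using sin[OF k] by auto
    qed
  qed
  have "reverses_blocks n \<pi> s"
    unfolding reverses_blocks_def set\<pi>
  proof (intro conjI s ballI impI)
    fix X assume "X \<in> B ` {1..n}"
    then obtain k where k: "k \<in> {1..n}" "X = B k" by blast
    have "s ` X \<subseteq> X"
    proof
      fix y assume "y \<in> s ` X"
      then obtain x where x: "x \<in> B k" "y = s x" using k by blast
      then show "y \<in> X" using maps[of x] k by (auto simp: B_def)
    qed
    moreover have "finite X" using k by (simp add: B_def)
    ultimately show "s ` X = X" using endo_inj_surj inj_on_subset[OF inj] by blast
    show "s y < s x" if "x \<in> X" "y \<in> X" "x < y" for x y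
      using rev[of x y] that k by (auto simp: B_def)
  qed
  then have "s = block_reversal n \<pi>"
    using reverses_blocks_unique[OF op] reverses_blocks_block_reversal[OF op] by blast
  then show ?thesis using op nt by blast
qed

section \<open>Weighted graphs\<close>

lemma wdist_eqI:
  assumes "is_path G u p v" "path_weight G p = k"
    and "\<And>p. is_path G u p v \<Longrightarrow> k \<le> path_weight G p"
  shows "wdist G u v = enat k"
  unfolding wdist_def
proof (rule antisym)
  show "(INF p \<in> {p. is_path G u p v}. enat (path_weight G p)) \<le> enat k"
    using assms(1,2) by (metis INF_lower mem_Collect_eq)
  show "enat k \<le> (INF p \<in> {p. is_path G u p v}. enat (path_weight G p))"
    using assms(3) by (intro INF_greatest) simp
qed

text \<open>The triangle inequality is summed along the list. The map \<open>f\<close> is left open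
  so that the bound serves the region graph (with the permutation of a region) and graphs on
  permutations (with \<open>id\<close>).\<close>

lemma path_weight_ge_perm_dist:
  assumes "p \<noteq> []" and "f ` set p \<subseteq> Sym n"
    and "\<And>x y. {x, y} \<in> edges G \<Longrightarrow> weight G x y = perm_dist n (f x) (f y)"
    and "successively (\<lambda>x y. {x, y} \<in> edges G) p"
  shows "perm_dist n (f (hd p)) (f (last p)) \<le> path_weight G p"
  using assms
proof (induction G p rule: path_weight.induct)
  case (1 G x y p)
  have "perm_dist n (f y) (f (last (y # p))) \<le> path_weight G (y # p)"
    using "1.IH" "1.prems" by (auto simp: successively_Cons)
  moreover have "weight G x y = perm_dist n (f x) (f y)" using "1.prems" by simp
  moreover have "f y \<in> Sym n" using "1.prems" by simp
  ultimately show ?case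
    using perm_dist_triangle[of "f y" n "f x" "f (last (y # p))"] by simp
qed (auto simp: perm_dist_self)

text \<open>Weights are natural numbers, so an initial piece only adds. This excludes a return to
  the starting vertex in \<open>exists_shortest_path\<close>.\<close>

lemma path_weight_suffix_le: "path_weight G ys \<le> path_weight G (xs @ ys)"
proof (induction xs)
  case (Cons x xs)
  show ?case
  proof (cases "xs @ ys")
    case (Cons z zs)
    then show ?thesis using Cons.IH by simp
  qed (use Cons.IH in simp)
qed simp

lemma path_weight_map:
  assumes "\<And>x y. {x, y} \<in> edges G \<Longrightarrow> weight H (f x) (f y) = weight G x y"
    and "successively (\<lambda>x y. {x, y} \<in> edges G) p"
  shows "path_weight H (map f p) = path_weight G p"
  using assms by (induction G p rule: path_weight.induct) (auto simp: successively_Cons)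

text \<open>Injectivity keeps the image of a path free of repeated vertices.\<close>

lemma is_path_map:
  assumes "is_path G u p v" and "inj_on f (verts G)" and "f ` verts G \<subseteq> verts H"
    and "\<And>x y. {x, y} \<in> edges G \<Longrightarrow> {f x, f y} \<in> edges H"
  shows "is_path H (f u) (map f p) (f v)"
proof -
  have "f ` set p \<subseteq> verts H" using assms(1,3) unfolding is_path_def by blast
  then show ?thesis
    using assms(1,2,4) unfolding is_path_def
    by (auto simp: hd_map last_map distinct_map successively_map intro: inj_on_subset
        elim: successively_mono)
qed

section \<open>Affine functions\<close>

text \<open>This shape covers the differences of the \<open>g i\<close>, negation
  (\<open>r = 0\<close>, \<open>s = 1\<close>), and the expressions
  \<open>f p * h x - h p * f x\<close> that test proportionality.\<close>

lemma affine_fun_combine: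
  assumes "affine_fun f" "affine_fun g"
  shows "affine_fun (\<lambda>x. r * f x - s * g x)"
proof -
  obtain a b c d where "\<And>x. f x = a \<bullet> x + b" "\<And>x. g x = c \<bullet> x + d"
    using assms unfolding affine_fun_def by blast
  then have "r * f x - s * g x = (r *\<^sub>R a - s *\<^sub>R c) \<bullet> x + (r * b - s * d)" for x
    by (simp add: algebra_simps)
  then show ?thesis unfolding affine_fun_def by blast
qed

lemma affine_fun_diff:
  assumes "affine_fun f" "affine_fun g"
  shows "affine_fun (\<lambda>x. f x - g x)"
  using affine_fun_combine[OF assms, of 1 1] by simp

lemma affine_fun_continuous: "affine_fun f \<Longrightarrow> continuous_on S f"
proof -
  assume "affine_fun f"
  then obtain a b where "f = (\<lambda>x. a \<bullet> x + b)" unfolding affine_fun_def by blast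
  then show ?thesis by (auto intro!: continuous_intros)
qed

lemma affine_fun_segment:
  assumes "affine_fun f" and "u + v = 1"
  shows "f (u *\<^sub>R x + v *\<^sub>R y) = u * f x + v * f y"
proof -
  obtain a b where f: "\<And>x. f x = a \<bullet> x + b" using assms unfolding affine_fun_def by blast
  have "b = u * b + v * b" using assms(2) by (metis distrib_right mult_1)
  then show ?thesis by (simp add: f inner_add_right algebra_simps)
qed

lemma affine_fun_hyperplane:
  fixes f :: "'a::euclidean_space \<Rightarrow> real"
  assumes "affine_fun f" and "f x = 0" and "f y \<noteq> 0"
  shows "\<exists>a b. a \<noteq> 0 \<and> (\<forall>x. f x = a \<bullet> x - b)"
proof -
  obtain a b where f: "\<And>x. f x = a \<bullet> x + b" using assms unfolding affine_fun_def by blast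
  then have "a \<noteq> 0" using assms by auto
  moreover have "\<forall>x. f x = a \<bullet> x - (- b)" using f by simp
  ultimately show ?thesis by blast
qed

lemma affine_zero_set: "affine_fun f \<Longrightarrow> affine {x. f x = 0}"
  unfolding affine_def by (simp add: affine_fun_segment)

lemma convex_pos_set: "affine_fun f \<Longrightarrow> convex {x. 0 < f x}"
  unfolding convex_def
proof (clarsimp simp: affine_fun_segment)
  fix x y and u v :: real
  assume "0 < f x" "0 < f y" "0 \<le> u" "0 \<le> v" "u + v = 1"
  then show "0 < u * f x + v * f y"
    by (metis add_nonneg_pos add_pos_nonneg less_eq_real_def mult_nonneg_nonneg mult_pos_pos
        zero_less_one add_0)
qed

lemma open_pos_set: "affine_fun f \<Longrightarrow> open {x. 0 < f x}"
  by (intro open_Collect_less continuous_on_const affine_fun_continuous)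

lemma closed_nonneg_set: "affine_fun f \<Longrightarrow> closed {x. 0 \<le> f x}"
  by (intro closed_Collect_le continuous_on_const affine_fun_continuous)

lemma affine_fun_nonneg_on_closure:
  assumes "affine_fun f" and "\<And>x. x \<in> S \<Longrightarrow> 0 < f x" and "x \<in> closure S"
  shows "0 \<le> f x"
proof -
  have "S \<subseteq> {x. 0 \<le> f x}" using assms(2) by (simp add: less_imp_le subset_iff)
  then have "closure S \<subseteq> {x. 0 \<le> f x}" using closed_nonneg_set[OF assms(1)] by (rule closure_minimal)
  then show ?thesis using assms(3) by blast
qed

lemma negligible_affine_zero_set:
  fixes f :: "'a::euclidean_space \<Rightarrow> real"
  assumes "affine_fun f" and "f y \<noteq> 0"
  shows "negligible {x. f x = 0}"
proof (cases "\<exists>x. f x = 0")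
  case True
  then obtain a b where "a \<noteq> 0" "\<forall>x. f x = a \<bullet> x - b"
    using affine_fun_hyperplane assms by metis
  then have "{x. f x = 0} = {x. a \<bullet> x = b}" by auto
  then show ?thesis using negligible_hyperplane[of a b] \<open>a \<noteq> 0\<close> by simp
qed simp

lemma connected_constant_sign:
  assumes "connected S" "affine_fun f" "\<And>x. x \<in> S \<Longrightarrow> f x \<noteq> 0" "x \<in> S" "y \<in> S" "0 < f x"
  shows "0 < f y"
proof (rule ccontr)
  assume "\<not> 0 < f y"
  then have "f y \<le> 0" by simp
  moreover have "connected (f ` S)"
    using connected_continuous_image[OF affine_fun_continuous[OF assms(2)] assms(1)] .
  ultimately have "0 \<in> f ` S"
    using assms(4-6) connectedD_interval[of "f ` S" "f y" "f x" 0] by auto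
  then show False using assms(3) by auto
qed

text \<open>Both functions vanish on a set that, together with a point where they do not vanish, spans the
  whole space; hence they are proportional.\<close>

lemma affine_funs_proportional:
  fixes f h :: "'a::euclidean_space \<Rightarrow> real"
  assumes "affine_fun f" "affine_fun h" and "aff_dim F = DIM('a) - 1"
    and "\<And>x. x \<in> F \<Longrightarrow> f x = 0" "\<And>x. x \<in> F \<Longrightarrow> h x = 0" and "f p \<noteq> 0"
  shows "f p * h x = h p * f x"
proof -
  have "affine hull F \<subseteq> {x. f x = 0}"
    using assms(4) by (intro hull_minimal affine_zero_set assms(1)) auto
  then have "p \<notin> affine hull F" using assms(6) by blast
  then have "aff_dim (insert p F) = DIM('a)" using assms(3) by (simp add: aff_dim_insert)
  then have "affine hull (insert p F) = UNIV" by (simp add: aff_dim_eq_full)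
  moreover have "affine hull (insert p F) \<subseteq> {x. f p * h x - h p * f x = 0}"
    using assms(4,5) by (intro hull_minimal affine_zero_set affine_fun_combine assms(1,2)) auto
  ultimately show ?thesis by auto
qed

section \<open>The facet along a cutting hyperplane\<close>

lemma aff_dim_closure: "aff_dim (closure S) = aff_dim (S :: 'a::euclidean_space set)"
  by (metis aff_dim_affine_hull closure_same_affine_hull)

text \<open>The cut is a face because \<open>f\<close> is nonnegative on the closure of the positive
  side, and has codimension one because \<open>W\<close> is open and meets the hyperplane. The main
  point is that a limit of the positive side lying on the hyperplane is a limit of points of
  \<open>W\<close> on it.\<close>

lemma facet_of_halfspace_cut:
  fixes f :: "'a::euclidean_space \<Rightarrow> real"
  assumes W: "open W" "convex W" and f: "affine_fun f" and z: "z \<in> W" "f z = 0"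
    and y: "f y \<noteq> 0"
  shows "closure (W \<inter> {x. f x = 0}) facet_of closure (W \<inter> {x. 0 < f x})"
proof -
  obtain a b where ab: "a \<noteq> 0" "\<And>x. f x = a \<bullet> x - b"
    using affine_fun_hyperplane[OF f z(2) y] by blast
  have H: "{x. f x = 0} = {x. a \<bullet> x = b}" using ab by auto
  let ?P = "W \<inter> {x. 0 < f x}" and ?H = "{x. f x = 0}"
  have oP: "open ?P" and cP: "convex ?P"
    using W open_pos_set[OF f] convex_pos_set[OF f] by (auto intro: convex_Int)
  \<comment> \<open>Moving from \<open>x\<close> a little along the normal vector \<open>a\<close>
    stays in \<open>W\<close> and makes \<open>f\<close> positive.\<close>
  have sub: "x \<in> closure ?P" if x: "x \<in> W" "f x = 0" for x
  proof -
    have "\<forall>\<^sub>F t in at_right 0. x + t *\<^sub>R a \<in> W"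
    proof (rule topological_tendstoD[OF _ W(1)])
      show "((\<lambda>t. x + t *\<^sub>R a) \<longlongrightarrow> x) (at_right (0::real))"
        by (rule tendsto_eq_intros refl | simp)+
    qed (use x in simp)
    moreover have "\<forall>\<^sub>F t in at_right 0. (0::real) < t" by (simp add: eventually_at_right_less)
    ultimately have "\<forall>\<^sub>F t in at_right 0. x + t *\<^sub>R a \<in> ?P"
    proof eventually_elim
      case (elim t)
      have "f (x + t *\<^sub>R a) = t * (a \<bullet> a)" using x(2) by (simp add: ab inner_add_right)
      then show ?case using elim ab(1) by simp
    qed
    then have "\<forall>\<^sub>F t in at_right 0. x + t *\<^sub>R a \<in> closure ?P"
      using closure_subset[of ?P] by (auto elim!: eventually_mono)
    moreover have "((\<lambda>t. x + t *\<^sub>R a) \<longlongrightarrow> x) (at_right (0::real))"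
      by (rule tendsto_eq_intros refl | simp)+
    ultimately show ?thesis
      by (intro Lim_in_closed_set[OF closed_closure _ trivial_limit_at_right_real])
  qed
  have eq: "closure (W \<inter> ?H) = closure ?P \<inter> ?H"
  proof (intro equalityI subsetI)
    fix x assume "x \<in> closure (W \<inter> ?H)"
    moreover have "closure (W \<inter> ?H) \<subseteq> closure ?P" using sub by (intro closure_minimal) auto
    moreover have "closure (W \<inter> ?H) \<subseteq> ?H"
      by (intro closure_minimal) (auto simp: H closed_hyperplane)
    ultimately show "x \<in> closure ?P \<inter> ?H" by blast
  next
    fix x assume x: "x \<in> closure ?P \<inter> ?H"
    then have xW: "x \<in> closure W" using closure_mono[of ?P W] by blast
    \<comment> \<open>The limit \<open>x\<close> may lie outside \<open>W\<close>, but the open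
      segment to it from \<open>z\<close> lies in \<open>W\<close> and on the hyperplane, and
      accumulates at \<open>x\<close> unless \<open>x = z\<close>.\<close>
    have "open_segment z x \<subseteq> W \<inter> ?H"
    proof
      fix y assume y: "y \<in> open_segment z x"
      then have "y \<in> interior W"
        using in_interior_closure_convex_segment[OF W(2) _ xW, of z] z W(1) interior_open by blast
      moreover have "f y = 0"
        using y x z affine_zero_set[OF f] unfolding in_segment
        by (auto simp: affine_fun_segment[OF f])
      ultimately show "y \<in> W \<inter> ?H" using interior_subset by blast
    qed
    moreover have "x \<in> closure (open_segment z x) \<or> x = z"
      by (simp add: closure_open_segment)
    ultimately show "x \<in> closure (W \<inter> ?H)"
      using closure_mono z closure_subset[of "W \<inter> ?H"] by blast
  qed
  have ge: "0 \<le> f x" if "x \<in> closure ?P" for x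
    by (rule affine_fun_nonneg_on_closure[OF f _ that]) simp
  have "closure ?P \<inter> {x. a \<bullet> x = b} face_of closure ?P"
    using ge ab by (intro face_of_Int_supporting_hyperplane_ge convex_closure cP) force
  then have "closure (W \<inter> ?H) face_of closure ?P" unfolding eq by (simp only: H)
  moreover have "closure (W \<inter> ?H) \<noteq> {}" using z closure_subset[of "W \<inter> ?H"] by blast
  moreover have "aff_dim (closure (W \<inter> ?H)) = DIM('a) - 1"
  proof -
    have "aff_dim (?H \<inter> W) = aff_dim ?H"
    proof (rule aff_dim_convex_Int_open)
      show "convex ?H" unfolding H by (rule convex_hyperplane)
    qed (use z W in auto)
    then show ?thesis using ab(1) by (simp add: H Int_commute aff_dim_closure)
  qed
  moreover have "aff_dim (closure ?P) = DIM('a)"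
    using sub[OF z] oP by (metis aff_dim_closure aff_dim_open closure_empty empty_iff)
  ultimately show ?thesis unfolding facet_of_def by simp
qed

text \<open>Apart from finitely many hyperplanes, every choice of \<open>q\<close> makes the segment from \<open>p\<close> to \<open>q\<close>
  cross the hyperplanes of the arrangement one at a time: if \<open>f p * h q = h p * f q\<close> only for
  proportional \<open>f\<close> and \<open>h\<close>, then only proportional ones vanish at the same point of the segment.\<close>

lemma exists_point_in_general_position:
  fixes Q :: "'b::euclidean_space set"
  assumes "open Q" "Q \<noteq> {}" "finite \<F>" "\<And>f. f \<in> \<F> \<Longrightarrow> affine_fun f"
  shows "\<exists>q \<in> Q. \<forall>f \<in> \<F>. \<forall>h \<in> \<F>. f p * h q = h p * f q \<longrightarrow> (\<forall>x. f p * h x = h p * f x)"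
proof -
  define Z where "Z = {(f, h) \<in> \<F> \<times> \<F>. \<exists>x. f p * h x \<noteq> h p * f x}"
  define N where "N = (\<Union>(f, h) \<in> Z. {x. f p * h x - h p * f x = 0})"
  have "finite Z" unfolding Z_def using assms(3) by (auto intro: finite_subset[of _ "\<F> \<times> \<F>"])
  moreover have "negligible {x. f p * h x - h p * f x = 0}" if fh: "(f, h) \<in> Z" for f h
  proof -
    obtain x where "f p * h x - h p * f x \<noteq> 0" using fh unfolding Z_def by auto
    moreover have "affine_fun (\<lambda>x. f p * h x - h p * f x)"
      using fh assms(4) unfolding Z_def by (intro affine_fun_combine) auto
    ultimately show ?thesis by (intro negligible_affine_zero_set) auto
  qed
  ultimately have "negligible N" unfolding N_def by (intro negligible_Union) auto
  then have "\<not> Q \<subseteq> N" using open_not_negligible[OF assms(1,2)] negligible_subset by blast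
  then obtain q where q: "q \<in> Q" "q \<notin> N" by blast
  then show ?thesis unfolding N_def Z_def by (intro bexI[of _ q]) auto
qed

lemma affine_fun_pos_on_segment:
  assumes "affine_fun f" "0 \<le> t" "t \<le> 1" "0 < f p" "0 < f q"
  shows "0 < f ((1 - t) *\<^sub>R p + t *\<^sub>R q)"
  using convexD[OF convex_pos_set[OF assms(1)], of p q "1 - t" t] assms(2-5) by simp

section \<open>Regions as order cells\<close>

locale affine_family =
  fixes D :: "'a::euclidean_space set" and n :: nat and g :: "nat \<Rightarrow> 'a \<Rightarrow> real"
  assumes convex_domain: "convex D"
    and affine_g: "i \<in> {1..n} \<Longrightarrow> affine_fun (g i)"
    and distinct_g: "i \<in> {1..n} \<Longrightarrow> j \<in> {1..n} \<Longrightarrow> i \<noteq> j \<Longrightarrow> \<exists>x. g i x \<noteq> g j x"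
begin

text \<open>By \<open>generic_iff\<close>, the points of the interior that avoid every hyperplane of
  the arrangement.\<close>

definition generic :: "'a set" where
  "generic = {x \<in> interior D. inj_on (\<lambda>i. g i x) {1..n}}"

text \<open>For generic \<open>x\<close> this is the region containing \<open>x\<close>. The
  one-sided implication displays it as a finite intersection of positivity sets, whence it is open
  and convex.\<close>

definition cell :: "'a \<Rightarrow> 'a set" where
  "cell x = {y \<in> interior D. \<forall>i \<in> {1..n}. \<forall>j \<in> {1..n}. g i x < g j x \<longrightarrow> g i y < g j y}"

lemma affine_diff: "i \<in> {1..n} \<Longrightarrow> j \<in> {1..n} \<Longrightarrow> affine_fun (\<lambda>x. g j x - g i x)"
  by (intro affine_fun_diff affine_g)

lemma cell_self: "x \<in> generic \<Longrightarrow> x \<in> cell x"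
  by (simp add: generic_def cell_def)

text \<open>At a generic point the values are strictly and totally ordered, so preserving the order
  also reflects it.\<close>

lemma cell_less_iff:
  assumes "x \<in> generic" "y \<in> cell x" "i \<in> {1..n}" "j \<in> {1..n}"
  shows "g i y < g j y \<longleftrightarrow> g i x < g j x"
proof -
  have 1: "g i x < g j x \<Longrightarrow> g i y < g j y" "g j x < g i x \<Longrightarrow> g j y < g i y"
    using assms unfolding cell_def by blast+
  moreover have "i = j" if "g i x = g j x"
    using assms that by (auto simp: generic_def dest: inj_onD)
  ultimately show ?thesis by (metis less_irrefl linorder_less_linear order_less_asym)
qed

lemma cell_subset_generic:
  assumes "x \<in> generic" shows "cell x \<subseteq> generic"
proof
  fix y assume y: "y \<in> cell x"
  have "i = j" if "i \<in> {1..n}" "j \<in> {1..n}" "g i y = g j y" for i j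
  proof -
    have "g i x = g j x"
      using cell_less_iff[OF assms y that(1,2)] cell_less_iff[OF assms y that(2,1)] that(3) by simp
    then show ?thesis using assms that by (auto simp: generic_def dest: inj_onD)
  qed
  then show "y \<in> generic" using y by (auto simp: generic_def cell_def intro: inj_onI)
qed

lemma cell_eq:
  assumes "x \<in> generic" "y \<in> cell x" shows "cell y = cell x"
  using cell_less_iff[OF assms] unfolding cell_def by auto

lemma cell_alt:
  "cell x = interior D \<inter>
    (\<Inter>(i, j) \<in> {(i, j) \<in> {1..n} \<times> {1..n}. g i x < g j x}. {y. 0 < g j y - g i y})"
  unfolding cell_def by auto

lemma convex_cell: "convex (cell x)"
  unfolding cell_alt
proof (intro convex_Int convex_interior convex_domain convex_INT, clarify)
  show "convex {y. 0 < g j y - g i y}" if "i \<in> {1..n}" "j \<in> {1..n}" for i j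
    by (intro convex_pos_set affine_diff that)
qed

lemma open_cell: "open (cell x)"
  unfolding cell_alt
proof (intro open_Int open_interior open_INT ballI, goal_cases)
  case 1
  then show ?case by (rule finite_subset[of _ "{1..n} \<times> {1..n}"]) auto
next
  case (2 e)
  then obtain i j where "e = (i, j)" "i \<in> {1..n}" "j \<in> {1..n}" by blast
  then show ?case using open_pos_set[OF affine_diff[of i j]] by simp
qed

section \<open>Regions are the cells of generic points\<close>

lemma zero_set_in_arrangement:
  assumes ij: "i \<in> {1..n}" "j \<in> {1..n}" "i \<noteq> j" and x: "\<exists>x \<in> interior D. g i x = g j x"
  shows "{x. g i x = g j x} \<in> arrangement D n g"
proof -
  obtain y where "g i y \<noteq> g j y" using distinct_g ij by blast
  moreover obtain w where "g i w = g j w" using x by blast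
  ultimately obtain a b where ab: "a \<noteq> 0" "\<And>x. g j x - g i x = a \<bullet> x - b"
    using affine_fun_hyperplane[OF affine_diff[OF ij(1,2)], of w y] by auto
  have "(g i x = g j x) = (a \<bullet> x = b)" for x using ab(2)[of x] by auto
  then have "hyperplane {x. g i x = g j x}" using ab(1) unfolding hyperplane_def by auto
  then show ?thesis using ij x unfolding arrangement_def by blast
qed

lemma generic_iff:
  assumes "x \<in> interior D"
  shows "x \<in> generic \<longleftrightarrow> x \<notin> \<Union> (arrangement D n g)"
proof
  assume x: "x \<in> generic"
  have False if h: "x \<in> h" "h \<in> arrangement D n g" for h
  proof -
    obtain i j where ij: "i \<in> {1..n}" "j \<in> {1..n}" "h = {x. g i x = g j x}" and "hyperplane h"
      using h(2) unfolding arrangement_def by blast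
    \<comment> \<open>The definition of \<open>arrangement\<close> admits \<open>i = j\<close>, but
      the solution set is then the whole space, which is no hyperplane: \<open>a \<bullet> x\<close>
      differs at \<open>0\<close> and at \<open>a\<close>.\<close>
    have "i = j" using x h(1) ij by (auto simp: generic_def dest: inj_onD)
    then have "h = UNIV" using ij by simp
    moreover obtain a b where ab: "a \<noteq> 0" "h = {x. a \<bullet> x = b}"
      using \<open>hyperplane h\<close> unfolding hyperplane_def by blast
    ultimately have "a \<bullet> 0 = b" "a \<bullet> a = b" by blast+
    then show False using ab(1) by simp
  qed
  then show "x \<notin> \<Union> (arrangement D n g)" by blast
next
  assume x: "x \<notin> \<Union> (arrangement D n g)"
  have "i = j" if ij: "i \<in> {1..n}" "j \<in> {1..n}" "g i x = g j x" for i j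
  proof (rule ccontr)
    assume "i \<noteq> j"
    then have "{x. g i x = g j x} \<in> arrangement D n g"
      using zero_set_in_arrangement ij assms by blast
    then show False using x ij by blast
  qed
  then show "x \<in> generic" using assms by (auto simp: generic_def intro: inj_onI)
qed

text \<open>Every difference of two of the functions keeps its sign on \<open>C\<close> within the
  interior, so this part of \<open>C\<close> lies in the cell. Conversely, the cell is connected,
  avoids the arrangement and meets \<open>C\<close>.\<close>

lemma component_Int_interior_eq_cell:
  assumes C: "C \<in> components (- \<Union> (arrangement D n g))" and x: "x \<in> C" "x \<in> interior D"
  shows "x \<in> generic" "C \<inter> interior D = cell x"
proof -
  have sub: "C \<subseteq> - \<Union> (arrangement D n g)" using C by (rule in_components_subset)
  then show gx: "x \<in> generic" using generic_iff x by blast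
  have gen: "y \<in> generic" if "y \<in> C" "y \<in> interior D" for y
    using that sub generic_iff by blast
  show "C \<inter> interior D = cell x"
  proof (intro equalityI subsetI)
    fix y assume y: "y \<in> C \<inter> interior D"
    have "g i y < g j y" if ij: "i \<in> {1..n}" "j \<in> {1..n}" "g i x < g j x" for i j
    proof -
      define f where "f x = g j x - g i x" for x
      have af: "affine_fun f" unfolding f_def by (intro affine_diff ij)
      have fx: "0 < f x" using ij by (simp add: f_def)
      \<comment> \<open>A zero set that misses the interior is not in the arrangement, so
        \<open>C\<close> may cross it; the sign is then constant on the connected set
        \<open>interior D\<close> instead of on \<open>C\<close>.\<close>
      have "0 < f y"
      proof (cases "\<exists>w \<in> interior D. f w = 0")
        case False
        then show ?thesis
          using y x fx convex_connected[OF convex_interior[OF convex_domain]]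
          by (intro connected_constant_sign[OF _ af, of "interior D" x y]) auto
      next
        case True
        then have "{x. g i x = g j x} \<in> arrangement D n g"
          using ij by (intro zero_set_in_arrangement) (force simp: f_def)+
        then have "u \<notin> {x. g i x = g j x}" if "u \<in> C" for u using sub that by blast
        then have "f u \<noteq> 0" if "u \<in> C" for u using that by (force simp: f_def)
        then show ?thesis
          using y x fx in_components_connected[OF C]
          by (intro connected_constant_sign[OF _ af, of C x y]) auto
      qed
      then show ?thesis by (simp add: f_def)
    qed
    then show "y \<in> cell x" using y by (simp add: cell_def)
  next
    fix y assume y: "y \<in> cell x"
    have "cell x \<subseteq> C"
    proof (rule components_maximal[OF C])
      show "connected (cell x)" by (rule convex_connected[OF convex_cell])
      show "cell x \<subseteq> - \<Union> (arrangement D n g)"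
        using cell_subset_generic[OF gx] generic_iff by (auto simp: generic_def)
      show "C \<inter> cell x \<noteq> {}" using x cell_self[OF gx] by blast
    qed
    then show "y \<in> C \<inter> interior D" using y by (auto simp: cell_def)
  qed
qed

lemma regions_eq: "regions D n g = cell ` generic"
proof (intro equalityI subsetI)
  fix R assume "R \<in> regions D n g"
  then obtain C x where "R = C \<inter> interior D" "C \<in> components (- \<Union> (arrangement D n g))"
    "x \<in> C" "x \<in> interior D" unfolding regions_def by blast
  then show "R \<in> cell ` generic" using component_Int_interior_eq_cell by blast
next
  fix R assume "R \<in> cell ` generic"
  then obtain x where x: "x \<in> generic" "R = cell x" by blast
  then have "x \<in> \<Union> (components (- \<Union> (arrangement D n g)))"
    using generic_iff by (auto simp: generic_def)
  then obtain C where C: "C \<in> components (- \<Union> (arrangement D n g))" "x \<in> C" by blast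
  have "R = C \<inter> interior D" "C \<inter> interior D \<noteq> {}"
    using component_Int_interior_eq_cell(2)[OF C] C(2) x by (auto simp: generic_def)
  then show "R \<in> regions D n g" using C(1) unfolding regions_def by blast
qed

text \<open>Any point of a region may serve as its base point, since cells of generic points are
  equal or disjoint.\<close>

lemma region_point:
  assumes "R \<in> regions D n g" "x \<in> R"
  shows "x \<in> generic" "R = cell x"
  using assms cell_subset_generic cell_eq unfolding regions_eq by blast+

lemma region_nonempty: "R \<in> regions D n g \<Longrightarrow> R \<noteq> {}"
  using cell_self unfolding regions_eq by blast

section \<open>The permutation of a region\<close>

abbreviation perm :: "'a set \<Rightarrow> nat \<Rightarrow> nat" where
  "perm \<equiv> region_perm n g"

text \<open>Sorting the values at one point sorts them on the whole cell, and the order at that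
  point leaves only one such permutation. So the definite description in \<open>region_perm\<close>
  is well defined.\<close>

lemma region_perm_orders:
  assumes "R \<in> regions D n g"
  shows "perm R \<in> Sym n" "orders n g R (perm R)"
proof -
  obtain x where x: "x \<in> R" using region_nonempty[OF assms] by blast
  note R = region_point[OF assms x]
  have "\<exists>\<alpha> \<in> Sym n. \<forall>k \<in> {1..n}. \<forall>l \<in> {1..n}. k < l \<longrightarrow> g (\<alpha> k) x < g (\<alpha> l) x"
    using R(1) by (intro sorting_Sym_exists) (simp add: generic_def)
  then obtain \<alpha> where \<alpha>: "\<alpha> \<in> Sym n"
    "\<And>k l. k \<in> {1..n} \<Longrightarrow> l \<in> {1..n} \<Longrightarrow> k < l \<Longrightarrow> g (\<alpha> k) x < g (\<alpha> l) x" by blast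
  have "orders n g R \<alpha>"
    unfolding orders_def
  proof (intro ballI impI)
    fix y k l assume y: "y \<in> R" and kl: "k \<in> {1..n}" "l \<in> {1..n}" "k < l"
    have "\<alpha> k \<in> {1..n}" "\<alpha> l \<in> {1..n}"
      using kl permutes_in_image[OF SymD[OF \<alpha>(1)]] by blast+
    then show "g (\<alpha> k) y < g (\<alpha> l) y"
      using cell_less_iff[OF R(1)] y R(2) \<alpha>(2)[OF kl] by blast
  qed
  moreover have "\<beta> = \<alpha>" if \<beta>: "\<beta> \<in> Sym n" "orders n g R \<beta>" for \<beta>
  proof (rule Sym_eqI[OF \<beta>(1) \<alpha>(1)])
    fix i j assume ij: "i \<in> {1..n}" "j \<in> {1..n}"
    have "before \<beta> i j \<longleftrightarrow> g i x < g j x"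
      using \<beta>(2) x ij by (intro Sym_before_iff[OF \<beta>(1)]) (auto simp: orders_def)
    moreover have "before \<alpha> i j \<longleftrightarrow> g i x < g j x" using \<alpha>(2) ij by (intro Sym_before_iff[OF \<alpha>(1)]) auto
    ultimately show "before \<beta> i j \<longleftrightarrow> before \<alpha> i j" by simp
  qed
  ultimately have "\<exists>!\<alpha>. \<alpha> \<in> Sym n \<and> orders n g R \<alpha>" using \<alpha>(1) by blast
  then have "perm R \<in> Sym n \<and> orders n g R (perm R)"
    unfolding region_perm_def by (rule theI')
  then show "perm R \<in> Sym n" "orders n g R (perm R)" by auto
qed

lemma before_perm_iff:
  assumes "R \<in> regions D n g" "x \<in> R" "i \<in> {1..n}" "j \<in> {1..n}"
  shows "before (perm R) i j \<longleftrightarrow> g i x < g j x"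
  using region_perm_orders[OF assms(1)] assms(2-4)
  by (intro Sym_before_iff) (auto simp: orders_def)

text \<open>Equal permutations mean equal comparisons at \<open>p\<close> and \<open>q\<close>,
  which puts \<open>q\<close> into the cell of \<open>p\<close>.\<close>

lemma inj_on_perm: "inj_on perm (regions D n g)"
proof (rule inj_onI)
  fix P Q assume PQ: "P \<in> regions D n g" "Q \<in> regions D n g" "perm P = perm Q"
  obtain p q where p: "p \<in> P" and q: "q \<in> Q" using region_nonempty PQ by blast
  have "q \<in> interior D" using region_point(1)[OF PQ(2) q] by (simp add: generic_def)
  moreover have "g i p < g j p \<longleftrightarrow> g i q < g j q" if "i \<in> {1..n}" "j \<in> {1..n}" for i j
    using before_perm_iff[OF PQ(1) p that] before_perm_iff[OF PQ(2) q that] PQ(3) by simp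
  ultimately have "q \<in> cell p" by (auto simp: cell_def)
  then show "P = Q"
    using cell_eq region_point[OF PQ(1) p] region_point(2)[OF PQ(2) q] by blast
qed

section \<open>Adjacent regions\<close>

lemma aff_dim_region:
  assumes "R \<in> regions D n g" shows "aff_dim (closure R) = DIM('a)"
  using assms region_nonempty[OF assms] open_cell unfolding regions_eq
  by (metis aff_dim_closure aff_dim_open imageE)

text \<open>A difference that is positive on \<open>P\<close> and negative on \<open>Q\<close> is
  both nonnegative and nonpositive on the common facet. The converse compares it with one difference
  known to change sign.\<close>

lemma before_perm_flips_iff_zero_on_facet:
  assumes PQ: "P \<in> regions D n g" "Q \<in> regions D n g" "P \<noteq> Q"
    and F: "F facet_of closure P" "F facet_of closure Q"
    and ij: "i \<in> {1..n}" "j \<in> {1..n}" "before (perm P) i j"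
  shows "before (perm Q) j i \<longleftrightarrow> (\<forall>x \<in> F. g i x = g j x)"
proof -
  obtain p q where p: "p \<in> P" and q: "q \<in> Q" using region_nonempty PQ by blast
  have FP: "F \<subseteq> closure P" and FQ: "F \<subseteq> closure Q" and dim: "aff_dim F = DIM('a) - 1"
    using F aff_dim_region[OF PQ(1)] by (auto simp: facet_of_def dest: face_of_imp_subset)
  have zero: "g i x = g j x"
    if ij: "i \<in> {1..n}" "j \<in> {1..n}" "before (perm P) i j" "before (perm Q) j i" and x: "x \<in> F"
    for i j x
  proof -
    have "0 \<le> g j x - g i x"
      by (rule affine_fun_nonneg_on_closure[OF affine_diff[OF ij(1,2)], of P])
        (use before_perm_iff[OF PQ(1)] ij x FP in auto)
    moreover have "0 \<le> g i x - g j x"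
      by (rule affine_fun_nonneg_on_closure[OF affine_diff[OF ij(2,1)], of Q])
        (use before_perm_iff[OF PQ(2)] ij x FQ in auto)
    ultimately show ?thesis by simp
  qed
  have "perm P \<noteq> perm Q" using inj_on_perm PQ by (auto dest: inj_onD)
  \<comment> \<open>Distinct regions have distinct permutations, so some pair is reversed; its
    difference serves as the reference.\<close>
  then obtain k l where kl: "k \<in> {1..n}" "l \<in> {1..n}" "before (perm P) k l" "before (perm Q) l k"
    using Sym_eqI[OF region_perm_orders(1)[OF PQ(1)] region_perm_orders(1)[OF PQ(2)]]
      before_linear[OF region_perm_orders(1)[OF PQ(1)]] before_linear[OF region_perm_orders(1)[OF PQ(2)]]
    by (metis before_asym)
  have "before (perm Q) j i" if F0: "\<forall>x \<in> F. g i x = g j x"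
  proof -
    \<comment> \<open>Both differences vanish on \<open>F\<close>, hence are proportional. The
      factor is positive by the signs at \<open>p\<close>, so both are negative at
      \<open>q\<close>.\<close>
    have e: "(g l p - g k p) * (g j q - g i q) = (g j p - g i p) * (g l q - g k q)"
    proof (rule affine_funs_proportional[OF affine_diff[OF kl(1,2)] affine_diff[OF ij(1,2)] dim])
      show "g l x - g k x = 0" if "x \<in> F" for x using zero[OF kl that] by simp
      show "g j x - g i x = 0" if "x \<in> F" for x using F0 that by simp
      show "g l p - g k p \<noteq> 0" using before_perm_iff[OF PQ(1) p] kl by force
    qed
    have "0 < g l p - g k p" "0 < g j p - g i p" "g l q - g k q < 0"
      using before_perm_iff[OF PQ(1) p] before_perm_iff[OF PQ(2) q] kl ij by auto
    then have "g j q - g i q < 0" using e by (metis mult_less_0_iff mult_pos_neg order_less_asym)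
    then show ?thesis using before_perm_iff[OF PQ(2) q] ij by auto
  qed
  then show ?thesis using zero[OF ij] by blast
qed

text \<open>Positions are grouped by the restriction of their function to the facet. Exactly the
  pairs within a group are reversed, so \<open>block_reversal_of_fibres\<close> applies.\<close>

lemma adjacent_regions_imp_adjacent_perms:
  assumes PQ: "P \<in> regions D n g" "Q \<in> regions D n g" and adj: "adjacent_regions P Q"
  shows "adjacent_perms n (perm P) (perm Q)"
proof -
  obtain F where F: "P \<noteq> Q" "F facet_of closure P" "F facet_of closure Q"
    using adj unfolding adjacent_regions_def by blast
  define \<alpha> where "\<alpha> = perm P"
  define \<beta> where "\<beta> = perm Q"
  have \<alpha>: "\<alpha> \<in> Sym n" and \<beta>: "\<beta> \<in> Sym n"
    using region_perm_orders(1) PQ by (auto simp: \<alpha>_def \<beta>_def)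
  note p\<alpha> = SymD[OF \<alpha>] and p\<beta> = SymD[OF \<beta>]
  have in\<alpha>: "\<alpha> k \<in> {1..n}" if "k \<in> {1..n}" for k using permutes_in_image[OF p\<alpha>] that by blast
  have b\<alpha>: "before \<alpha> (\<alpha> k) (\<alpha> l) \<longleftrightarrow> k < l" for k l
    by (simp add: before_def permutes_inverses[OF p\<alpha>])
  have FP: "F \<subseteq> closure P" using F(2) by (rule facet_of_imp_subset)
  \<comment> \<open>Using \<open>restrict\<close> turns agreement on \<open>F\<close> into plain
    equality of functions.\<close>
  define c where "c k = restrict (g (\<alpha> k)) F" for k
  have c_eq: "c k = c l \<longleftrightarrow> (\<forall>x \<in> F. g (\<alpha> k) x = g (\<alpha> l) x)" for k l
    by (auto simp: c_def restrict_def fun_eq_iff)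
  have flip: "before \<beta> (\<alpha> l) (\<alpha> k) \<longleftrightarrow> c k = c l" if "k \<in> {1..n}" "l \<in> {1..n}" "k < l" for k l
    unfolding c_eq \<beta>_def
    using before_perm_flips_iff_zero_on_facet[OF PQ F in\<alpha>[OF that(1)] in\<alpha>[OF that(2)]]
      b\<alpha> that(3) by (simp add: \<alpha>_def)
  have le: "g (\<alpha> k) x \<le> g (\<alpha> l) x" if "k \<in> {1..n}" "l \<in> {1..n}" "k < l" "x \<in> F" for k l x
  proof -
    have "0 \<le> g (\<alpha> l) x - g (\<alpha> k) x"
      by (rule affine_fun_nonneg_on_closure[OF affine_diff[OF in\<alpha> in\<alpha>], of _ _ P])
        (use that FP region_perm_orders(2)[OF PQ(1)] in \<open>auto simp: orders_def \<alpha>_def\<close>)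
    then show ?thesis by simp
  qed
  have "\<alpha> \<noteq> \<beta>" using inj_on_perm PQ F(1) by (auto simp: \<alpha>_def \<beta>_def dest: inj_onD)
  have "\<exists>\<pi>. ordered_partition n \<pi> \<and> nontrivial_partition \<pi> \<and> inv \<beta> \<circ> \<alpha> = block_reversal n \<pi>"
  proof -
    obtain i j where ij: "i \<in> {1..n}" "j \<in> {1..n}" "before \<alpha> i j" "before \<beta> j i"
      using Sym_eqI[OF \<alpha> \<beta>] \<open>\<alpha> \<noteq> \<beta>\<close> before_linear[OF \<alpha>] before_linear[OF \<beta>]
      by (metis before_asym)
    define k0 where "k0 = inv \<alpha> i"
    define l0 where "l0 = inv \<alpha> j"
    have kl: "k0 \<in> {1..n}" "l0 \<in> {1..n}" "k0 < l0" "\<alpha> k0 = i" "\<alpha> l0 = j"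
      using Sym_inv_in[OF \<alpha>] ij permutes_inverses[OF p\<alpha>] by (auto simp: k0_def l0_def before_def)
    show ?thesis
    proof (rule block_reversal_of_fibres[where c = c and ?k0.0 = k0 and ?l0.0 = l0])
      show "inv \<beta> \<circ> \<alpha> permutes {1..n}" by (intro permutes_compose p\<alpha> permutes_inv p\<beta>)
      \<comment> \<open>On the facet the order of \<open>P\<close> survives as a weak order, which
        squeezes the function at position \<open>l\<close> between two equal ones.\<close>
      show "c l = c k" if h: "k \<in> {1..n}" "m \<in> {1..n}" "k < l" "l < m" "c k = c m" for k l m
        unfolding c_eq
      proof
        fix x assume x: "x \<in> F"
        have "l \<in> {1..n}" using h by auto
        then have "g (\<alpha> k) x \<le> g (\<alpha> l) x" "g (\<alpha> l) x \<le> g (\<alpha> m) x" using le h x by blast+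
        moreover have "g (\<alpha> k) x = g (\<alpha> m) x" using h(5) x by (simp add: c_eq)
        ultimately show "g (\<alpha> l) x = g (\<alpha> k) x" by simp
      qed
      show "(inv \<beta> \<circ> \<alpha>) l < (inv \<beta> \<circ> \<alpha>) k"
        if "k \<in> {1..n}" "l \<in> {1..n}" "k < l" "c k = c l" for k l
        using flip[OF that(1-3)] that(4) by (simp add: before_def)
      show "(inv \<beta> \<circ> \<alpha>) k < (inv \<beta> \<circ> \<alpha>) l"
        if "k \<in> {1..n}" "l \<in> {1..n}" "k < l" "c k \<noteq> c l" for k l
      proof -
        have "\<alpha> k \<noteq> \<alpha> l" using that(3) permutes_inj[OF p\<alpha>] by (auto dest: injD)
        then show ?thesis
          using flip[OF that(1-3)] that(4) before_linear[OF \<beta>] by (auto simp: before_def)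
      qed
      show "c k0 = c l0" using flip[OF kl(1-3)] ij kl by simp
    qed (use kl in auto)
  qed
  then show ?thesis using \<alpha> \<beta> unfolding adjacent_perms_def \<alpha>_def \<beta>_def by blast
qed

section \<open>Crossing from one region to the next\<close>

text \<open>Cutting \<open>W\<close> by \<open>f\<close> and by \<open>- f\<close> produces the same
  facet for both sides.\<close>

lemma adjacent_regions_halfspace_cuts:
  assumes PQ: "P \<in> regions D n g" "Q \<in> regions D n g"
    and W: "open W" "convex W" and f: "affine_fun f" and z: "z \<in> W" "f z = 0" and y: "0 < f y"
    and cut: "P = W \<inter> {x. 0 < f x}" "Q = W \<inter> {x. f x < 0}"
  shows "adjacent_regions P Q"
proof -
  have f': "affine_fun (\<lambda>x. - f x)" using affine_fun_combine[OF f f, of 0 1] by simp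
  have "closure (W \<inter> {x. f x = 0}) facet_of closure P"
    unfolding cut by (rule facet_of_halfspace_cut[OF W f z, of y]) (use y in simp)
  moreover have "closure (W \<inter> {x. f x = 0}) facet_of closure Q"
    unfolding cut using facet_of_halfspace_cut[OF W f' z(1), of y] z(2) y by simp
  moreover have "P \<noteq> Q" using region_nonempty[OF PQ(1)] unfolding cut by force
  ultimately show ?thesis unfolding adjacent_regions_def by blast
qed

text \<open>The condition on \<open>R\<close> is what \<open>perm_dist_between\<close> requires: the
  step from \<open>P\<close> to \<open>R\<close> costs exactly the distance it gains towards
  \<open>Q\<close>.\<close>

lemma exists_adjacent_region_towards:
  assumes PQ: "P \<in> regions D n g" "Q \<in> regions D n g" "P \<noteq> Q"
  shows "\<exists>R \<in> regions D n g. adjacent_regions P R \<and>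
    (\<forall>i \<in> {1..n}. \<forall>j \<in> {1..n}. before (perm P) i j \<longrightarrow> before (perm Q) i j \<longrightarrow> before (perm R) i j)"
proof -
  define f where "f e x = g (snd e) x - g (fst e) x" for e x
  define T where "T = {1..n} \<times> {1..n}"
  have fin: "finite T" by (simp add: T_def)
  have af: "affine_fun (f e)" if "e \<in> T" for e
    unfolding f_def using that by (intro affine_diff) (auto simp: T_def)
  obtain p where p: "p \<in> P" using region_nonempty PQ by blast
  have oQ: "open Q" using PQ(2) open_cell unfolding regions_eq by blast
  obtain q where q: "q \<in> Q" and gp:
    "\<And>e e'. e \<in> T \<Longrightarrow> e' \<in> T \<Longrightarrow> f e p * f e' q = f e' p * f e q \<Longrightarrow> (\<forall>x. f e p * f e' x = f e' p * f e x)"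
    using exists_point_in_general_position[OF oQ region_nonempty[OF PQ(2)], of "f ` T" p] fin af
    by blast
  note genp = region_point[OF PQ(1) p] and genq = region_point[OF PQ(2) q]
  have intpq: "p \<in> interior D" "q \<in> interior D" using genp genq by (auto simp: generic_def)
  have nz: "f (i, j) q \<noteq> 0" if "(i, j) \<in> T" "i \<noteq> j" for i j
    using genq(1) that by (auto simp: generic_def f_def T_def dest: inj_onD)
  \<comment> \<open>Each pair of distinct indices occurs in \<open>A\<close> with the orientation
    that is positive at \<open>p\<close>; \<open>S\<close> below collects those that become negative
    at \<open>q\<close>.\<close>
  define A where "A = {e \<in> T. 0 < f e p}"
  have A_T: "e \<in> T" "0 < f e p" "f e q \<noteq> 0" if "e \<in> A" for e
  proof -
    show "e \<in> T" "0 < f e p" using that by (auto simp: A_def)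
    then show "f e q \<noteq> 0" using nz[of "fst e" "snd e"] by (cases "fst e = snd e") (auto simp: f_def)
  qed
  have cell_p: "P = interior D \<inter> {y. \<forall>e \<in> A. 0 < f e y}"
    unfolding genp(2) by (auto simp: cell_def A_def T_def f_def)
  define S where "S = {e \<in> A. f e q < 0}"
  have "S \<noteq> {}"
  proof
    assume "S = {}"
    then have "\<forall>e \<in> A. 0 < f e q" using A_T by (force simp: S_def)
    then have "q \<in> P" using cell_p intpq by blast
    then show False using region_point(2)[OF PQ(1)] genq PQ(3) by blast
  qed
  have finA: "finite A" and finS: "finite S" using fin by (auto simp: A_def S_def)
  \<comment> \<open>The parameter at which \<open>f e\<close> vanishes on the segment from
    \<open>p\<close> to \<open>q\<close>; its minimum over \<open>S\<close> marks the first
    crossing.\<close>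
  define \<theta> where "\<theta> e = f e p / (f e p - f e q)" for e
  obtain e0 where e0: "e0 \<in> S" "\<And>e. e \<in> S \<Longrightarrow> \<theta> e0 \<le> \<theta> e"
    using ex_is_arg_min_if_finite[OF finS \<open>S \<noteq> {}\<close>, of \<theta>]
    by (auto simp: is_arg_min_linorder)
  have e0A: "e0 \<in> A" "f e0 q < 0" using e0(1) by (auto simp: S_def)
  define t0 where "t0 = \<theta> e0"
  have t0: "0 < t0" "t0 < 1" using A_T(2)[OF e0A(1)] e0A(2) by (auto simp: t0_def \<theta>_def field_simps)
  define s where "s t = (1 - t) *\<^sub>R p + t *\<^sub>R q" for t :: real
  have fs: "f e (s t) = (1 - t) * f e p + t * f e q" if "e \<in> A" for e t
    unfolding s_def by (intro affine_fun_segment af A_T that) simp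
  have fs': "f e (s t) = (\<theta> e - t) * (f e p - f e q)" if "e \<in> S" for e t
  proof -
    have "e \<in> A" "f e p - f e q \<noteq> 0" using that A_T(2)[of e] by (auto simp: S_def)
    then show ?thesis by (simp add: fs \<theta>_def field_simps)
  qed
  define z where "z = s t0"
  have z0: "f e0 z = 0" using fs'[OF e0(1)] by (simp add: z_def t0_def)
  \<comment> \<open>A function of \<open>A\<close> that is not positive at \<open>z\<close> must be
    in \<open>S\<close> and cross at the same parameter as \<open>f e0\<close>, since that one is
    minimal. General position of \<open>q\<close> then forces proportionality.\<close>
  have proportional: "f e0 p * f e x = f e p * f e0 x" if e: "e \<in> A" "\<not> 0 < f e z" for e x
  proof -
    have eS: "e \<in> S"
    proof (rule ccontr)
      assume "e \<notin> S"
      then have "0 < f e q" using e(1) A_T(3)[OF e(1)] by (simp add: S_def)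
      then have "0 < f e z"
        unfolding z_def s_def using t0 A_T[OF e(1)] af by (intro affine_fun_pos_on_segment[of "f e" t0 p q]) auto
      then show False using e(2) by blast
    qed
    have pos: "0 < f e p - f e q" using eS A_T(2)[OF e(1)] by (simp add: S_def)
    have "(\<theta> e - t0) * (f e p - f e q) \<le> 0" using fs'[OF eS, of t0] e(2) by (simp add: z_def)
    then have "\<theta> e \<le> t0" using pos by (simp add: mult_le_0_iff)
    then have "\<theta> e = \<theta> e0" using e0(2)[OF eS] by (simp add: t0_def)
    moreover have "0 < f e0 p - f e0 q" using e0A A_T(2)[OF e0A(1)] by simp
    ultimately have "f e p * (f e0 p - f e0 q) = f e0 p * (f e p - f e q)"
      using pos by (simp add: \<theta>_def frac_eq_eq)
    then have "f e0 p * f e q = f e p * f e0 q" by (simp add: algebra_simps)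
    then show ?thesis using gp A_T e e0A by blast
  qed
  \<comment> \<open>Only the constraints still strict at \<open>z\<close> are kept. The remaining
    ones all amount to the sign of \<open>f e0\<close>, so \<open>P\<close> and the region beyond
    are the two sides of \<open>W\<close>.\<close>
  define W where "W = interior D \<inter> (\<Inter>e \<in> {e \<in> A. 0 < f e z}. {y. 0 < f e y})"
  have posW: "0 < f e y" if "y \<in> W" "e \<in> A" "0 < f e z" for e y
    using that unfolding W_def by blast
  have oW: "open W" unfolding W_def
    using finA af A_T by (intro open_Int open_interior open_INT ballI open_pos_set) auto
  have cW: "convex W" unfolding W_def
    using af A_T convex_domain by (intro convex_Int convex_interior convex_INT convex_pos_set) auto
  have s_int: "s t \<in> interior D" if "0 \<le> t" "t \<le> 1" for t
    unfolding s_def using convexD[OF convex_interior[OF convex_domain] intpq, of "1 - t" t] that by simp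
  have zW: "z \<in> W" using s_int t0 by (auto simp: W_def z_def)
  have signs: "0 < f e y \<longleftrightarrow> 0 < f e0 y" "f e y < 0 \<longleftrightarrow> f e0 y < 0"
    if "e \<in> A" "\<not> 0 < f e z" for e y
  proof -
    have "0 < f e0 p" "0 < f e p" "f e0 p * f e y = f e p * f e0 y"
      using A_T proportional that e0A by blast+
    then show "0 < f e y \<longleftrightarrow> 0 < f e0 y" "f e y < 0 \<longleftrightarrow> f e0 y < 0"
      by (metis zero_less_mult_pos mult_pos_pos, metis mult_less_0_iff order_less_asym)
  qed
  have P_eq: "P = W \<inter> {x. 0 < f e0 x}"
    unfolding cell_p W_def using signs(1) e0A by blast
  \<comment> \<open>Just after the crossing the segment is still in the open set \<open>W\<close>,
    and \<open>f e0\<close> is negative there; this point becomes the base point of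
    \<open>R\<close>.\<close>
  have "\<exists>t. t0 < t \<and> t < 1 \<and> s t \<in> W"
  proof -
    have "(s \<longlongrightarrow> z) (at_right t0)"
      unfolding z_def s_def by (rule tendsto_eq_intros refl | simp)+
    then have "\<forall>\<^sub>F t in at_right t0. s t \<in> W" using oW zW by (rule topological_tendstoD)
    moreover have "\<forall>\<^sub>F t in at_right t0. t \<in> {t0<..<1}" using t0 by (intro eventually_at_right_real)
    ultimately have "\<forall>\<^sub>F t in at_right t0. t0 < t \<and> t < 1 \<and> s t \<in> W"
      by eventually_elim auto
    then show ?thesis using eventually_happens trivial_limit_at_right_real by blast
  qed
  then obtain t where t: "t0 < t" "t < 1" "s t \<in> W" by blast
  define z' where "z' = s t"
  have z'W: "z' \<in> W" and z'neg: "f e0 z' < 0"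
    using t fs'[OF e0(1), of t] e0A A_T(2)[OF e0A(1)]
    by (auto simp: z'_def t0_def mult_neg_pos)
  have sgn_z': "if 0 < f e z then 0 < f e z' else f e z' < 0" if "e \<in> A" for e
    using signs(2)[OF that] posW[OF z'W that] z'neg by auto
  have total: "(i, j) \<in> A \<or> (j, i) \<in> A" if "i \<in> {1..n}" "j \<in> {1..n}" "i \<noteq> j" for i j
  proof -
    have "g i p \<noteq> g j p" using genp(1) that by (auto simp: generic_def dest: inj_onD)
    then show ?thesis using that by (auto simp: A_def T_def f_def)
  qed
  have genz': "z' \<in> generic"
  proof -
    have "i = j" if ij: "i \<in> {1..n}" "j \<in> {1..n}" "g i z' = g j z'" for i j
    proof (rule ccontr)
      assume "i \<noteq> j"
      then obtain e where "e \<in> A" "f e z' = 0"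
        using total[OF ij(1,2)] ij(3) by (auto simp: f_def)
      then show False using sgn_z'[of e] by (auto split: if_splits)
    qed
    then show ?thesis using z'W by (auto simp: generic_def W_def intro: inj_onI)
  qed
  define R where "R = cell z'"
  have R: "R \<in> regions D n g" and z'R: "z' \<in> R"
    using genz' cell_self by (auto simp: R_def regions_eq)
  have R_eq: "R = W \<inter> {x. f e0 x < 0}"
  proof (intro equalityI subsetI)
    fix y assume y: "y \<in> R"
    have sg: "0 < f e y" if "e \<in> T" "0 < f e z'" for e
      using y that by (auto simp: R_def cell_def T_def f_def)
    have "y \<in> W" using sg sgn_z' A_T y by (auto simp: W_def R_def cell_def)
    moreover have "f e0 y < 0"
      \<comment> \<open>The reversed pair is the one whose difference is positive at
        \<open>z'\<close>.\<close>
      using sg[of "(snd e0, fst e0)"] z'neg A_T(1)[OF e0A(1)]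
      by (auto simp: T_def f_def)
    ultimately show "y \<in> W \<inter> {x. f e0 x < 0}" by blast
  next
    fix y assume y: "y \<in> W \<inter> {x. f e0 x < 0}"
    have sg: "if 0 < f e z then 0 < f e y else f e y < 0" if "e \<in> A" for e
      using signs(2)[OF that] posW[OF _ that] y by auto
    have "g i y < g j y" if ij: "i \<in> {1..n}" "j \<in> {1..n}" "g i z' < g j z'" for i j
    proof -
      have "i \<noteq> j" using ij by auto
      then consider "(i, j) \<in> A" | "(j, i) \<in> A" using total ij by blast
      then show ?thesis
      proof cases
        case 1
        then show ?thesis using sg[OF 1] sgn_z'[OF 1] ij(3) by (auto simp: f_def split: if_splits)
      next
        case 2
        then show ?thesis using sg[OF 2] sgn_z'[OF 2] ij(3) by (auto simp: f_def split: if_splits)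
      qed
    qed
    then show "y \<in> R" using y by (auto simp: R_def cell_def W_def)
  qed
  have "adjacent_regions P R"
    using A_T[OF e0A(1)]
    by (intro adjacent_regions_halfspace_cuts[OF PQ(1) R oW cW af zW z0 _ P_eq R_eq])
  moreover have "before (perm R) i j"
    if ij: "i \<in> {1..n}" "j \<in> {1..n}" "before (perm P) i j" "before (perm Q) i j" for i j
  proof -
    have "0 < f (i, j) p" "0 < f (i, j) q"
      using ij before_perm_iff[OF PQ(1) p] before_perm_iff[OF PQ(2) q] by (auto simp: f_def)
    then have "0 < f (i, j) z'"
      unfolding z'_def s_def using t t0 af ij by (intro affine_fun_pos_on_segment[of "f (i, j)" t p q]) (auto simp: T_def)
    then show ?thesis using before_perm_iff[OF R z'R] ij by (simp add: f_def)
  qed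
  ultimately show ?thesis using R by blast
qed

section \<open>The region graph\<close>

abbreviation graph :: "'a set wgraph" where
  "graph \<equiv> region_graph D n g"

lemma graph_simps:
  "verts graph = regions D n g"
  "weight graph P Q = perm_dist n (perm P) (perm Q)"
  by (simp_all add: region_graph_def)

text \<open>Adjacency of regions is symmetric, so it does not matter in which order an unordered
  pair is read.\<close>

lemma graph_edge_iff:
  "{P, Q} \<in> edges graph \<longleftrightarrow> P \<in> regions D n g \<and> Q \<in> regions D n g \<and> adjacent_regions P Q"
  unfolding region_graph_def adjacent_regions_def by (auto simp: doubleton_eq_iff)

lemma graph_path_weight_ge:
  assumes "is_path graph P p Q"
  shows "perm_dist n (perm P) (perm Q) \<le> path_weight graph p"
  using path_weight_ge_perm_dist[of p perm n graph] assms region_perm_orders(1)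
  unfolding is_path_def graph_simps by auto

text \<open>Induction on the distance of the permutations: after a step to the adjacent region
  towards \<open>Q\<close> the distances add up, and the remaining one is smaller since the
  permutations of \<open>P\<close> and \<open>R\<close> differ.\<close>

lemma exists_shortest_path:
  assumes "P \<in> regions D n g" "Q \<in> regions D n g"
  shows "\<exists>p. is_path graph P p Q \<and> path_weight graph p = perm_dist n (perm P) (perm Q)"
  using assms(1)
proof (induction "perm_dist n (perm P) (perm Q)" arbitrary: P rule: less_induct)
  case less
  show ?case
  proof (cases "P = Q")
    case True
    then show ?thesis using assms(2)
      by (intro exI[of _ "[P]"]) (simp add: is_path_def graph_simps perm_dist_self)
  next
    case False
    obtain R where R: "R \<in> regions D n g" "adjacent_regions P R"
      and btw: "\<And>i j. i \<in> {1..n} \<Longrightarrow> j \<in> {1..n} \<Longrightarrow> before (perm P) i j \<Longrightarrow> before (perm Q) i j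
        \<Longrightarrow> before (perm R) i j"
      using exists_adjacent_region_towards[OF less.prems assms(2) False] by blast
    note sym = region_perm_orders(1)[OF less.prems] region_perm_orders(1)[OF R(1)]
      region_perm_orders(1)[OF assms(2)]
    have sum: "perm_dist n (perm P) (perm Q) =
        perm_dist n (perm P) (perm R) + perm_dist n (perm R) (perm Q)"
      by (rule perm_dist_between[OF sym]) (rule btw)
    have "perm P \<noteq> perm R"
      using inj_on_perm less.prems R by (auto simp: adjacent_regions_def dest: inj_onD)
    then have lt: "perm_dist n (perm R) (perm Q) < perm_dist n (perm P) (perm Q)"
      using perm_dist_pos[OF sym(1,2)] sum by simp
    obtain p where p: "is_path graph R p Q" "path_weight graph p = perm_dist n (perm R) (perm Q)"
      using less.hyps[OF lt R(1)] by blast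
    \<comment> \<open>If \<open>p\<close> returned to \<open>P\<close>, its tail from there would
      weigh at least the distance from \<open>P\<close> to \<open>Q\<close>, which exceeds the
      weight of all of \<open>p\<close>.\<close>
    have "P \<notin> set p"
    proof
      assume "P \<in> set p"
      then obtain xs ys where xs: "p = xs @ P # ys" by (meson split_list)
      then have "is_path graph P (P # ys) Q"
        using p(1) unfolding is_path_def by (auto simp: successively_append_iff)
      then have "perm_dist n (perm P) (perm Q) \<le> path_weight graph (P # ys)"
        by (rule graph_path_weight_ge)
      also have "\<dots> \<le> path_weight graph p" unfolding xs by (rule path_weight_suffix_le)
      finally show False using lt p(2) by simp
    qed
    moreover obtain ys where ys: "p = R # ys" using p(1) unfolding is_path_def by (cases p) auto
    ultimately have "is_path graph P (P # p) Q"
      using p(1) less.prems R graph_edge_iff unfolding is_path_def by (auto simp: graph_simps)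
    moreover have "path_weight graph (P # p) = perm_dist n (perm P) (perm Q)"
      using p(2) sum by (simp add: ys graph_simps)
    ultimately show ?thesis by blast
  qed
qed

section \<open>Distances in the region graph, its image and the big permutograph\<close>

lemma wdist_graph:
  assumes "P \<in> regions D n g" "Q \<in> regions D n g"
  shows "wdist graph P Q = enat (perm_dist n (perm P) (perm Q))"
  using exists_shortest_path[OF assms] graph_path_weight_ge by (blast intro: wdist_eqI)

text \<open>The image of a shortest path attains the lower bound given by the triangle inequality.
  Leaving \<open>H\<close> open covers both the big permutograph and the image of the region
  graph.\<close>

lemma wdist_perm_eq:
  assumes "P \<in> regions D n g" "Q \<in> regions D n g"
    and "perm ` regions D n g \<subseteq> verts H" and "verts H \<subseteq> Sym n"
    and "\<And>P Q. {P, Q} \<in> edges graph \<Longrightarrow> {perm P, perm Q} \<in> edges H"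
    and "\<And>\<alpha> \<beta>. {\<alpha>, \<beta>} \<in> edges H \<Longrightarrow> weight H \<alpha> \<beta> = perm_dist n \<alpha> \<beta>"
  shows "wdist H (perm P) (perm Q) = enat (perm_dist n (perm P) (perm Q))"
proof -
  obtain p where p: "is_path graph P p Q" "path_weight graph p = perm_dist n (perm P) (perm Q)"
    using exists_shortest_path[OF assms(1,2)] by blast
  have "is_path H (perm P) (map perm p) (perm Q)"
    using is_path_map[OF p(1), of perm H] inj_on_perm assms(3,5) by (simp add: graph_simps)
  moreover have "path_weight H (map perm p) = perm_dist n (perm P) (perm Q)"
    using path_weight_map[of graph H perm p] p assms(5,6) by (simp add: graph_simps is_path_def)
  moreover have "perm_dist n (perm P) (perm Q) \<le> path_weight H r"
    if "is_path H (perm P) r (perm Q)" for r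
    using path_weight_ge_perm_dist[of r id n H] that assms(4,6) unfolding is_path_def by auto
  ultimately show ?thesis by (rule wdist_eqI)
qed

lemma graph_edge_image:
  assumes "{P, Q} \<in> edges graph"
  shows "{perm P, perm Q} \<in> edges (big_permutograph n)"
  using assms adjacent_regions_imp_adjacent_perms
  unfolding graph_edge_iff big_permutograph_def by auto

lemma wdist_big_permutograph:
  assumes "P \<in> regions D n g" "Q \<in> regions D n g"
  shows "wdist (big_permutograph n) (perm P) (perm Q) = enat (perm_dist n (perm P) (perm Q))"
  by (rule wdist_perm_eq[OF assms])
    (use graph_edge_image region_perm_orders(1) in \<open>auto simp: big_permutograph_def\<close>)

lemma isometric_embedding_perm: "isometric_embedding perm graph (big_permutograph n)"
  unfolding isometric_embedding_def graph_simps
  using inj_on_perm region_perm_orders(1) graph_edge_image wdist_graph wdist_big_permutograph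
  by (auto simp: big_permutograph_def)

lemma permutograph_image: "permutograph n (image_graph perm graph)"
proof -
  let ?H = "image_graph perm graph" and ?B = "big_permutograph n"
  have V: "verts ?H = perm ` regions D n g" by (simp add: image_graph_def graph_simps)
  have VB: "verts ?H \<subseteq> Sym n" using region_perm_orders(1) by (auto simp: V)
  have edgeE: "\<exists>P Q. {P, Q} \<in> edges graph \<and> e = {perm P, perm Q}" if "e \<in> edges ?H" for e
  proof -
    have "e \<in> (\<lambda>e. perm ` e) ` edges graph" using that by (simp add: image_graph_def)
    then obtain e' where "e = perm ` e'" "e' \<in> edges graph" by (rule imageE)
    moreover obtain P Q where "e' = {P, Q}" using calculation(2) unfolding region_graph_def by auto
    ultimately show ?thesis by (intro exI[of _ P] exI[of _ Q]) simp
  qed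
  have edgeI: "{perm P, perm Q} \<in> edges ?H" if "{P, Q} \<in> edges graph" for P Q
    using imageI[OF that, of "\<lambda>e. perm ` e"] by (simp add: image_graph_def)
  have in_V: "e \<subseteq> verts ?H" and in_B: "e \<in> edges ?B" if e: "e \<in> edges ?H" for e
  proof -
    obtain P Q where PQ: "{P, Q} \<in> edges graph" "e = {perm P, perm Q}" using edgeE[OF e] by blast
    then show "e \<subseteq> verts ?H" by (auto simp: V graph_edge_iff)
    show "e \<in> edges ?B" using PQ graph_edge_image by simp
  qed
  \<comment> \<open>The carried-over weights are computed through \<open>inv_into\<close>, which is
    a right inverse only on image vertices; \<open>in_V\<close> places both ends there.\<close>
  have wt: "weight ?H \<alpha> \<beta> = perm_dist n \<alpha> \<beta>" if "{\<alpha>, \<beta>} \<in> edges ?H" for \<alpha> \<beta>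
    using in_V[OF that] by (auto simp: image_graph_def graph_simps f_inv_into_f)
  have "weighted_subgraph ?H ?B"
    using VB in_V in_B wt unfolding weighted_subgraph_def by (auto simp: big_permutograph_def)
  moreover have "wdist ?H \<alpha> \<beta> = wdist ?B \<alpha> \<beta>" if ab: "\<alpha> \<in> verts ?H" "\<beta> \<in> verts ?H" for \<alpha> \<beta>
  proof -
    obtain P Q where PQ: "P \<in> regions D n g" "Q \<in> regions D n g" "\<alpha> = perm P" "\<beta> = perm Q"
      using ab by (auto simp: V)
    have "wdist ?H (perm P) (perm Q) = enat (perm_dist n (perm P) (perm Q))"
      using V VB edgeI wt by (intro wdist_perm_eq PQ) auto
    then show ?thesis using wdist_big_permutograph PQ by simp
  qed
  ultimately show ?thesis unfolding permutograph_def isometric_weighted_subgraph_def by blast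
qed

end

theorem theorem4:
  fixes D :: "(real ^ 'd) set" and n :: nat and g :: "nat \<Rightarrow> real ^ 'd \<Rightarrow> real"
  assumes "closed_domain D" and "convex D"
    and "\<forall>i \<in> {1..n}. affine_fun (g i)"
    and "\<forall>i \<in> {1..n}. \<forall>j \<in> {1..n}. i \<noteq> j \<longrightarrow> (\<exists>x \<in> D. g i x \<noteq> g j x)"
    and "\<exists>i \<in> {1..n}. \<exists>j \<in> {1..n}. i \<noteq> j \<and> interior D \<inter> {x. g i x = g j x} \<noteq> {}"
  shows "(\<forall>R \<in> regions D n g. region_perm n g R \<in> Sym n \<and> orders n g R (region_perm n g R))
    \<and> inj_on (region_perm n g) (regions D n g)
    \<and> (\<forall>P \<in> regions D n g. \<forall>Q \<in> regions D n g.
         adjacent_regions P Q \<longrightarrow> adjacent_perms n (region_perm n g P) (region_perm n g Q))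
    \<and> isometric_embedding (region_perm n g) (region_graph D n g) (big_permutograph n)
    \<and> (\<forall>P \<in> regions D n g. \<forall>Q \<in> regions D n g.
         wdist (region_graph D n g) P Q = enat (perm_dist n (region_perm n g P) (region_perm n g Q)))
    \<and> permutograph n (image_graph (region_perm n g) (region_graph D n g))"
proof -
  interpret affine_family D n g
    using assms(2-4) by unfold_locales blast+
  show ?thesis
    using region_perm_orders inj_on_perm adjacent_regions_imp_adjacent_perms
      isometric_embedding_perm wdist_graph permutograph_image by blast
qed

end
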